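(* Let $X\subset \mathbb{P}^n$ be a smooth projective variety defined over $\mathbb{Q}$. If $X$ is $\mathbb{Q}$-unirational, then $X$ has finite saturation, i.e. its saturation number satisfies $r(X)<\infty$.
   Context: For an integer $m$, $\Omega(m):=\sum_p \nu_p(m)$ is the number of prime divisors of $m$ counted with multiplicity ($\nu_p$ is the $p$-adic valuation), with $\Omega(m)=\infty$ if and only if $m=0$. For $x\in\mathbb{P}^n(\mathbb{Q})$ write $x=[\mathbf{x}]$ with $\mathbf{x}=(x_0,\ldots,x_n)\in\mathbb{Z}^{n+1}$, $\gcd(x_0,\ldots,x_n)=1$, and put $\Omega_{\mathbb{P}^n(\mathbb{Q})}(x):=\Omega\big(\prod_{i=0}^n x_i\big)$; this is well defined. Saturation number: for a variety $X\subset\mathbb{P}^n$ defined over $\mathbb{Q}$, $r(X)$ is the least $r\in\mathbb{N}\cup\{\infty\}$ such that the set of points $x\in X(\mathbb{Q})$ with $\Omega_{\mathbb{P}^n(\mathbb{Q})}(x)\leq r$ is Zariski dense in $X$. A variety $X$ over $\mathbb{Q}$ is $\mathbb{Q}$-unirational if there exist a positive integer $m$ and a dominant rational map $\pi:\mathbb{P}^m\dashrightarrow X$ defined over $\mathbb{Q}$.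
   Formalization: The formal theorem adds the hypothesis that X lies in no coordinate hyperplane x_i = 0; otherwise Ω is infinite at every rational point and r(X) = ∞, as for the smooth rational line x_2 = 0 in P^2. *)

theory Defs
  imports
    "HOL-Analysis.Analysis"
    "HOL-Computational_Algebra.Primes"
    "HOL-Library.Extended_Nat"
    "HOL-Library.Function_Algebras"
    "HOL-Library.Poly_Mapping"
begin

section \<open>Polynomials in several variables over the rational numbers\<close>

text \<open>
  A polynomial in \<open>x\<^sub>0, x\<^sub>1, \<dots>\<close> is a finitely supported map from exponent vectors to coefficients;
  the ring operations are those of \<^theory>\<open>HOL-Library.Poly_Mapping\<close>.
\<close>

type_synonym qpoly = "(nat \<Rightarrow>\<^sub>0 nat) \<Rightarrow>\<^sub>0 rat"

definition poly_eval :: "qpoly \<Rightarrow> (nat \<Rightarrow> complex) \<Rightarrow> complex" where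
  "poly_eval f x =
     (\<Sum>m\<in>Poly_Mapping.keys f. of_rat (Poly_Mapping.lookup f m) *
        (\<Prod>i\<in>Poly_Mapping.keys m. x i ^ Poly_Mapping.lookup m i))"

text \<open>Homogeneous of degree \<open>d\<close> and involving only the variables \<open>x\<^sub>0, \<dots>, x\<^sub>n\<close>; the zero polynomial
  is homogeneous of every degree.\<close>

definition homogeneous :: "nat \<Rightarrow> nat \<Rightarrow> qpoly \<Rightarrow> bool" where
  "homogeneous n d f \<longleftrightarrow>
     (\<forall>m\<in>Poly_Mapping.keys f. Poly_Mapping.keys m \<subseteq> {..n} \<and>
        (\<Sum>i\<in>Poly_Mapping.keys m. Poly_Mapping.lookup m i) = d)"

text \<open>Monomials not involving \<open>x\<^sub>i\<close> contribute \<open>0\<close>, so the truncated subtraction is harmless.\<close>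

definition partial_deriv :: "nat \<Rightarrow> qpoly \<Rightarrow> qpoly" where
  "partial_deriv i f =
     (\<Sum>m\<in>Poly_Mapping.keys f.
        Poly_Mapping.single (m - Poly_Mapping.single i 1)
          (Poly_Mapping.lookup f m * of_nat (Poly_Mapping.lookup m i)))"


section \<open>Projective space and its Zariski topology\<close>

text \<open>
  A point of projective \<open>n\<close>-space is the set of all its homogeneous coordinate vectors. A vector in
  \<open>n + 1\<close> coordinates is a function on \<^typ>\<open>nat\<close> that vanishes beyond \<open>n\<close>.
\<close>

type_synonym ppoint = "(nat \<Rightarrow> complex) set"

definition proj_class :: "(nat \<Rightarrow> complex) \<Rightarrow> ppoint" where
  "proj_class x = {(\<lambda>i. c * x i) | c. c \<noteq> 0}"

definition coord_vectors :: "nat \<Rightarrow> (nat \<Rightarrow> complex) set" where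
  "coord_vectors n = {x. (\<forall>i>n. x i = 0) \<and> (\<exists>i\<le>n. x i \<noteq> 0)}"

definition proj_space :: "nat \<Rightarrow> ppoint set" where
  "proj_space n = proj_class ` coord_vectors n"

definition rational_points :: "ppoint set \<Rightarrow> ppoint set" where
  "rational_points X = {p \<in> X. \<exists>x\<in>p. \<forall>i. x i \<in> \<rat>}"

text \<open>
  Everything takes place over the ground field \<open>\<rat>\<close>: the closed sets are the sets of complex points
  cut out by homogeneous polynomials with rational coefficients, and correspond to the closed
  subsets of the scheme \<open>\<P>\<^sup>n\<close> over \<open>\<rat>\<close>. The generating sets are
  closed under finite intersections (multiply the polynomials), hence a basis.
\<close>

definition basic_open :: "nat \<Rightarrow> qpoly \<Rightarrow> ppoint set" where
  "basic_open n f = {p \<in> proj_space n. \<forall>x\<in>p. poly_eval f x \<noteq> 0}"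

definition zariski :: "nat \<Rightarrow> ppoint topology" where
  "zariski n = topology_generated_by {basic_open n f | f d. homogeneous n d f}"

definition zariski_dense_in :: "nat \<Rightarrow> ppoint set \<Rightarrow> ppoint set \<Rightarrow> bool" where
  "zariski_dense_in n S X \<longleftrightarrow> S \<subseteq> X \<and> X \<subseteq> zariski n closure_of S"


section \<open>Projective varieties over the rational numbers\<close>

definition irreducible_in :: "'a topology \<Rightarrow> 'a set \<Rightarrow> bool" where
  "irreducible_in T Z \<longleftrightarrow>
     Z \<noteq> {} \<and> (\<forall>A B. closedin T A \<longrightarrow> closedin T B \<longrightarrow> Z \<subseteq> A \<union> B \<longrightarrow> Z \<subseteq> A \<or> Z \<subseteq> B)"

text \<open>Irreducible over \<open>\<rat>\<close>, i.e. an integral closed subscheme of \<open>\<P>\<^sup>n\<close> over \<open>\<rat>\<close>;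
  geometric irreducibility is not required.\<close>

definition projective_variety :: "nat \<Rightarrow> ppoint set \<Rightarrow> bool" where
  "projective_variety n X \<longleftrightarrow> closedin (zariski n) X \<and> irreducible_in (zariski n) X"

definition zariski_dim :: "nat \<Rightarrow> ppoint set \<Rightarrow> enat" where
  "zariski_dim n X =
     Sup {enat d | d. \<exists>Z :: nat \<Rightarrow> ppoint set.
        (\<forall>i\<le>d. closedin (zariski n) (Z i) \<and> irreducible_in (zariski n) (Z i) \<and> Z i \<subseteq> X) \<and>
        (\<forall>i<d. Z i \<subset> Z (Suc i))}"

text \<open>The homogeneous elements of the vanishing ideal of \<open>X\<close>; they generate it.\<close>

definition vanishing_forms :: "nat \<Rightarrow> ppoint set \<Rightarrow> qpoly set" where
  "vanishing_forms n X =
     {f. (\<exists>d. homogeneous n d f) \<and> (\<forall>p\<in>X. \<forall>x\<in>p. poly_eval f x = 0)}"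

interpretation cvec: vector_space "\<lambda>(c::complex) (v::nat \<Rightarrow> complex) i. c * v i"
  by unfold_locales (simp_all add: fun_eq_iff algebra_simps)

text \<open>The rank of the Jacobian matrix at \<open>x\<close> is the dimension of its row space.\<close>

definition jacobian_rank :: "nat \<Rightarrow> ppoint set \<Rightarrow> (nat \<Rightarrow> complex) \<Rightarrow> nat" where
  "jacobian_rank n X x =
     cvec.dim ((\<lambda>f i. poly_eval (partial_deriv i f) x) ` vanishing_forms n X)"

text \<open>Jacobian criterion: at each geometric point the rank is \<open>n - dim X\<close>.\<close>

definition smooth_variety :: "nat \<Rightarrow> ppoint set \<Rightarrow> bool" where
  "smooth_variety n X \<longleftrightarrow>
     projective_variety n X \<and>
     (\<forall>p\<in>X. \<forall>x\<in>p. enat (jacobian_rank n X x) + zariski_dim n X = enat n)"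


section \<open>Unirationality\<close>

text \<open>
  A rational map from \<open>\<P>\<^sup>m\<close> to \<open>\<P>\<^sup>n\<close> over \<open>\<rat>\<close> is given by forms \<open>F\<^sub>0, \<dots>, F\<^sub>n\<close>
  of a common degree that are not all zero, and is defined (at least) where they do not all vanish.
\<close>

definition represents_rational_map :: "nat \<Rightarrow> nat \<Rightarrow> (nat \<Rightarrow> qpoly) \<Rightarrow> bool" where
  "represents_rational_map m n F \<longleftrightarrow>
     (\<exists>d. \<forall>i\<le>n. homogeneous m d (F i)) \<and> (\<exists>i\<le>n. F i \<noteq> 0)"

definition rational_map_image :: "nat \<Rightarrow> nat \<Rightarrow> (nat \<Rightarrow> qpoly) \<Rightarrow> ppoint set" where
  "rational_map_image m n F =
     {proj_class (\<lambda>i. if i \<le> n then poly_eval (F i) t else 0) | t.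
        t \<in> coord_vectors m \<and> (\<exists>i\<le>n. poly_eval (F i) t \<noteq> 0)}"

definition unirational :: "nat \<Rightarrow> ppoint set \<Rightarrow> bool" where
  "unirational n X \<longleftrightarrow>
     (\<exists>m\<ge>1. \<exists>F. represents_rational_map m n F \<and>
        zariski_dense_in n (rational_map_image m n F) X)"


section \<open>The saturation number\<close>

definition Omega :: "int \<Rightarrow> enat" where
  "Omega m = (if m = 0 then \<infinity> else enat (\<Sum>p\<in>prime_factors m. multiplicity p m))"

definition primitive_coords :: "nat \<Rightarrow> ppoint \<Rightarrow> (nat \<Rightarrow> int) \<Rightarrow> bool" where
  "primitive_coords n p a \<longleftrightarrow>
     Gcd (a ` {..n}) = 1 \<and> p = proj_class (\<lambda>i. if i \<le> n then of_int (a i) else 0)"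

definition Omega_proj :: "nat \<Rightarrow> ppoint \<Rightarrow> enat" where
  "Omega_proj n p = (THE k. \<exists>a. primitive_coords n p a \<and> k = Omega (\<Prod>i\<le>n. a i))"

lemma Omega_minus: "Omega (- m) = Omega m"
proof -
  have "prime_factors (- m) = prime_factors m"
    by (cases "m = 0") (simp_all add: prime_factors_dvd)
  moreover have "multiplicity p (- m) = multiplicity p m" for p
    by (rule multiplicity_cong) simp
  ultimately show ?thesis
    by (simp add: Omega_def)
qed

lemma primitive_coords_unique:
  assumes "primitive_coords n p a" "primitive_coords n p b"
  shows "\<exists>s\<in>{1, -1}. \<forall>i\<le>n. b i = s * a i"
proof -
  let ?v = "\<lambda>a i. if i \<le> n then complex_of_int (a i) else 0"
  have ga: "Gcd (a ` {..n}) = 1" and gb: "Gcd (b ` {..n}) = 1"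
    and eq: "proj_class (?v a) = proj_class (?v b)"
    using assms by (auto simp: primitive_coords_def)
  have "?v b \<in> proj_class (?v b)"
    unfolding proj_class_def by (rule CollectI, rule exI[of _ 1]) auto
  then obtain c where c: "c \<noteq> 0" "?v b = (\<lambda>i. c * ?v a i)"
    unfolding eq[symmetric] by (auto simp: proj_class_def)
  have bc: "complex_of_int (b i) = c * complex_of_int (a i)" if "i \<le> n" for i
    using fun_cong[OF c(2), of i] that by simp
  have "\<exists>j\<le>n. a j \<noteq> 0"
  proof (rule ccontr)
    assume "\<not> ?thesis"
    then have "a ` {..n} \<subseteq> {0}" by auto
    then have "Gcd (a ` {..n}) = 0" by (simp add: Gcd_0_iff)
    with ga show False by simp
  qed
  then obtain j where j: "j \<le> n" "a j \<noteq> 0" by blast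
  have cross: "a j * b i = b j * a i" if "i \<le> n" for i
  proof -
    have "complex_of_int (a j * b i) = complex_of_int (b j * a i)"
      using bc[OF that] bc[OF j(1)] by simp
    then show ?thesis unfolding of_int_eq_iff .
  qed
  have "(*) (a j) ` b ` {..n} = (*) (b j) ` a ` {..n}"
    unfolding image_image by (rule image_cong) (auto simp: cross)
  then have "Gcd ((*) (a j) ` b ` {..n}) = Gcd ((*) (b j) ` a ` {..n})"
    by simp
  then have "\<bar>a j\<bar> = \<bar>b j\<bar>"
    unfolding Gcd_mult ga gb by simp
  then obtain s :: int where s: "s \<in> {1, -1}" "b j = s * a j"
    unfolding abs_eq_iff by fastforce
  have "b i = s * a i" if "i \<le> n" for i
    using cross[OF that] s j(2) by auto
  with s(1) show ?thesis by blast
qed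

lemma Omega_proj_eq:
  assumes "primitive_coords n p a"
  shows "Omega_proj n p = Omega (\<Prod>i\<le>n. a i)"
proof -
  have "Omega (\<Prod>i\<le>n. b i) = Omega (\<Prod>i\<le>n. a i)" if "primitive_coords n p b" for b
  proof -
    obtain s where s: "s \<in> {1, -1}" "\<forall>i\<le>n. b i = s * a i"
      using primitive_coords_unique[OF assms \<open>primitive_coords n p b\<close>] by blast
    then have "(\<Prod>i\<le>n. b i) = (\<Prod>i\<le>n. s * a i)"
      by (intro prod.cong) auto
    then have "(\<Prod>i\<le>n. b i) = s ^ Suc n * (\<Prod>i\<le>n. a i)"
      by (simp only: prod.distrib prod_constant card_atMost)
    moreover have "s ^ Suc n = 1 \<or> s ^ Suc n = -1"
      using s(1)
      by (metis insertE power_one neg_one_even_power neg_one_odd_power singletonD)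
    ultimately show ?thesis
      using Omega_minus by fastforce
  qed
  with assms show ?thesis
    unfolding Omega_proj_def by (blast intro: the_equality)
qed

text \<open>
  The infimum is attained (\<^typ>\<open>enat\<close> is well-ordered) unless the set is empty, i.e. the rational
  points are not dense in \<open>X\<close>; in that case the value is \<open>\<infinity>\<close>.
\<close>

definition saturation_number :: "nat \<Rightarrow> ppoint set \<Rightarrow> enat" where
  "saturation_number n X =
     Inf {r. zariski_dense_in n {p \<in> rational_points X. Omega_proj n p \<le> r} X}"

text \<open>
  On a variety contained in a coordinate hyperplane \<open>x\<^sub>i = 0\<close>, every rational point has
  \<^const>\<open>Omega_proj\<close> equal to \<open>\<infinity>\<close>, so the saturation number is \<open>\<infinity>\<close> by definition.
\<close>

definition in_coord_hyperplane :: "nat \<Rightarrow> ppoint set \<Rightarrow> bool" where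
  "in_coord_hyperplane n X \<longleftrightarrow> (\<exists>i\<le>n. \<forall>p\<in>X. \<forall>x\<in>p. x i = 0)"

end

theory Submission
  imports Defs "HOL-Number_Theory.Cong" "HOL-Computational_Algebra.Polynomial"
    "HOL-Real_Asymp.Real_Asymp"
begin

text \<open>
  Let \<open>F\<close> be forms parametrising \<open>X\<close>. Fix an integer point \<open>a\<close> with all \<open>F\<^sub>i(a) \<noteq> 0\<close> and put
  \<open>c = \<Prod> K F\<^sub>i(a)\<close>, where \<open>K\<close> clears denominators. On a line \<open>a + c M s b\<close> with integral direction \<open>b\<close>
  the product of the values \<open>K F\<^sub>i\<close> is \<open>c g(s)\<close> for an integer polynomial \<open>g\<close> of bounded degree with
  \<open>g(0) = 1\<close> and \<open>g \<equiv> 1\<close> modulo \<open>M\<close>, so \<open>g\<close> has no small fixed prime divisors. The Brun-Hooley sieve yields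
  infinitely many \<open>s\<close> for which \<open>g(s)\<close> has at most \<open>r\<close> prime factors, with \<open>r\<close> depending only on the
  degree bound. Given a nonempty open subset of \<open>X\<close>, a suitable direction \<open>b\<close> makes the line meet it
  in all but finitely many \<open>s\<close>.
\<close>

section \<open>Truncated inclusion-exclusion\<close>

text \<open>The obstacle is uniformity: one bound must serve every open set, although the direction
  of the line, and with it the coefficients of \<open>g\<close>, cannot be controlled. So whatever
  enters the bound may depend on the degree only. Because \<open>g(0) = 1\<close>, the polynomial
  \<open>g\<close> vanishes identically modulo no prime and has at most \<open>deg g\<close> roots
  modulo each of them, whatever its coefficients are. This bounds the density of sifted residues by
  1/2 once the prime exceeds twice the degree bound; the smaller primes are removed by the
  congruence modulo \<open>M\<close>. The coefficients influence only how far out the sieve begins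
  to work, and this costs nothing because infinitely many \<open>s\<close> are available. Since the
  number of roots per prime can be as large as the degree, the sieve must work in arbitrary
  dimension, but a positive lower bound is enough: if no prime below \<open>z\<close> divides a
  value of size at most \<open>z^r\<close>, that value has at most \<open>r\<close> prime
  factors.\<close>

definition multiaffine :: "('a set \<Rightarrow> real) \<Rightarrow> 'a set \<Rightarrow> ('a \<Rightarrow> real) \<Rightarrow> real" where
  "multiaffine c V h = (\<Sum>T\<in>Pow V. c T * prod h T)"

lemma multiaffine_insert:
  assumes "finite V" "x \<notin> V"
  shows "multiaffine c (insert x V) h =
    multiaffine c V h + h x * multiaffine (\<lambda>T. c (insert x T)) V h"
proof -
  have "inj_on (insert x) (Pow V)"
    using assms(2) by (auto simp: inj_on_def)
  moreover have "prod h (insert x T) = h x * prod h T" if "T \<in> Pow V" for T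
    using assms that by (subst prod.insert) (auto intro: finite_subset)
  moreover have "Pow V \<inter> insert x ` Pow V = {}"
    using assms(2) by auto
  ultimately show ?thesis
    using assms(1) by (simp add: multiaffine_def Pow_insert sum.union_disjoint sum.reindex
        sum_distrib_left algebra_simps)
qed

text \<open>Disjointness of \<open>V\<close> and \<open>W\<close> makes the pair
  \<open>(S, T)\<close> recoverable from \<open>S \<union> T\<close>, so no square of a variable
  arises. Hence a product of block weights is again multiaffine, and its coefficients can be read
  off block by block.\<close>

lemma multiaffine_mult:
  assumes "finite V" "finite W" "V \<inter> W = {}"
  shows "multiaffine c V h * multiaffine d W h =
    multiaffine (\<lambda>T. c (T \<inter> V) * d (T \<inter> W)) (V \<union> W) h"
proof -
  have "multiaffine c V h * multiaffine d W h =
      (\<Sum>(S, T)\<in>Pow V \<times> Pow W. c S * d T * prod h (S \<union> T))"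
    unfolding multiaffine_def sum_product sum.cartesian_product
  proof (intro sum.cong refl, clarify)
    fix S T assume "S \<subseteq> V" "T \<subseteq> W"
    then have "prod h (S \<union> T) = prod h S * prod h T"
      using assms by (intro prod.union_disjoint) (auto intro: finite_subset)
    then show "c S * prod h S * (d T * prod h T) = c S * d T * prod h (S \<union> T)"
      by simp
  qed
  also have "\<dots> = multiaffine (\<lambda>T. c (T \<inter> V) * d (T \<inter> W)) (V \<union> W) h"
    unfolding multiaffine_def
  proof (rule sum.reindex_bij_witness[where
        i = "\<lambda>T. (T \<inter> V, T \<inter> W)" and j = "\<lambda>(S, T). S \<union> T"], goal_cases)
    case (1 a) then show ?case using assms(3) by auto
  next
    case (2 a) then show ?case by auto
  next
    case (3 b) then show ?case by auto
  next
    case (4 b) then show ?case by auto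
  next
    case (5 a)
    then obtain S T where a: "a = (S, T)" "S \<subseteq> V" "T \<subseteq> W" by auto
    then have "(S \<union> T) \<inter> V = S" "(S \<union> T) \<inter> W = T" using assms(3) by auto
    with a show ?case by simp
  qed
  finally show ?thesis .
qed

lemma multiaffine_prod:
  assumes "finite I" "\<And>j. j \<in> I \<Longrightarrow> finite (V j)" "disjoint_family_on V I"
  shows "(\<Prod>j\<in>I. multiaffine (c j) (V j) h) =
    multiaffine (\<lambda>T. \<Prod>j\<in>I. c j (T \<inter> V j)) (\<Union>j\<in>I. V j) h"
  using assms
proof (induction I rule: finite_induct)
  case empty
  show ?case by (simp add: multiaffine_def)
next
  case (insert i I)
  have disj: "V i \<inter> (\<Union>j\<in>I. V j) = {}"
    using disjoint_family_onD[OF insert.prems(2), of i] insert.hyps(2) by fastforce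
  have "(\<Prod>j\<in>I. multiaffine (c j) (V j) h) =
      multiaffine (\<lambda>T. \<Prod>j\<in>I. c j (T \<inter> V j)) (\<Union>j\<in>I. V j) h"
    using insert.prems disjoint_family_on_mono[of I "insert i I" V] by (intro insert.IH) auto
  then have "(\<Prod>j\<in>insert i I. multiaffine (c j) (V j) h) =
      multiaffine (c i) (V i) h * multiaffine (\<lambda>T. \<Prod>j\<in>I. c j (T \<inter> V j)) (\<Union>j\<in>I. V j) h"
    using insert.hyps by simp
  also have "\<dots> = multiaffine (\<lambda>T. c i (T \<inter> V i) * (\<Prod>j\<in>I. c j (T \<inter> (\<Union>j\<in>I. V j) \<inter> V j)))
      (V i \<union> (\<Union>j\<in>I. V j)) h"
    using insert disj by (intro multiaffine_mult) auto
  also have "\<dots> = multiaffine (\<lambda>T. \<Prod>j\<in>insert i I. c j (T \<inter> V j)) (\<Union>j\<in>insert i I. V j) h"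
  proof -
    have "(\<Prod>j\<in>I. c j (T \<inter> (\<Union>j\<in>I. V j) \<inter> V j)) = (\<Prod>j\<in>I. c j (T \<inter> V j))" for T
      by (intro prod.cong refl arg_cong[where f = "c _"]) auto
    then show ?thesis using insert.hyps by simp
  qed
  finally show ?case .
qed

text \<open>By linearity: counts known for each monomial, that is, for simultaneous divisibility by
  the primes in \<open>T\<close>, transfer to every sieve weight. The errors add up to the same
  polynomial with absolute coefficients, evaluated at \<open>\<rho>\<close>.\<close>

lemma multiaffine_average:
  assumes "\<And>T. T \<subseteq> V \<Longrightarrow> \<bar>(\<Sum>a\<in>A. prod (f a) T) - N * prod h T\<bar> \<le> prod \<rho> T"
  shows "\<bar>(\<Sum>a\<in>A. multiaffine c V (f a)) - N * multiaffine c V h\<bar>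
    \<le> multiaffine (\<lambda>T. \<bar>c T\<bar>) V \<rho>"
proof -
  have "(\<Sum>a\<in>A. multiaffine c V (f a)) - N * multiaffine c V h =
      (\<Sum>T\<in>Pow V. c T * ((\<Sum>a\<in>A. prod (f a) T) - N * prod h T))"
    unfolding multiaffine_def
    by (subst sum.swap) (simp add: sum_distrib_left sum_subtractf algebra_simps)
  also have "\<bar>\<dots>\<bar> \<le> (\<Sum>T\<in>Pow V. \<bar>c T * ((\<Sum>a\<in>A. prod (f a) T) - N * prod h T)\<bar>)"
    by (rule sum_abs)
  also have "\<dots> \<le> (\<Sum>T\<in>Pow V. \<bar>c T\<bar> * prod \<rho> T)"
    using assms by (intro sum_mono) (auto simp: abs_mult intro: mult_left_mono)
  finally show ?thesis by (simp add: multiaffine_def)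
qed

section \<open>Elementary symmetric sums, Bonferroni's and Hooley's inequalities\<close>

definition esym :: "nat \<Rightarrow> 'a set \<Rightarrow> ('a \<Rightarrow> real) \<Rightarrow> real" where
  "esym k = multiaffine (\<lambda>T. if card T = k then 1 else 0)"

text \<open>Inclusion-exclusion for the product of the \<open>1 - h x\<close>, cut off at subsets of
  size \<open>k\<close>. At 0/1 indicators it is a sieve weight, at local densities it gives the
  main term.\<close>

definition bonf :: "nat \<Rightarrow> 'a set \<Rightarrow> ('a \<Rightarrow> real) \<Rightarrow> real" where
  "bonf k = multiaffine (\<lambda>T. if card T \<le> k then (-1) ^ card T else 0)"

lemma multiaffine_cong:
  assumes "\<And>T. T \<subseteq> V \<Longrightarrow> c T = d T"
  shows "multiaffine c V h = multiaffine d V h"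
  unfolding multiaffine_def using assms by (intro sum.cong) auto

lemma card_insert_subset: "finite V \<Longrightarrow> x \<notin> V \<Longrightarrow> T \<subseteq> V \<Longrightarrow> card (insert x T) = Suc (card T)"
  by (subst card_insert_disjoint) (auto intro: finite_subset)

lemma esym_0: "finite V \<Longrightarrow> esym 0 V h = 1"
proof -
  assume "finite V"
  then have "esym 0 V h = (\<Sum>T\<in>Pow V. if T = {} then 1 else 0)"
    unfolding esym_def multiaffine_def
    by (intro sum.cong refl) (auto dest: finite_subset)
  with \<open>finite V\<close> show ?thesis by simp
qed

lemma esym_insert:
  assumes "finite V" "x \<notin> V"
  shows "esym (Suc k) (insert x V) h = esym (Suc k) V h + h x * esym k V h"
  unfolding esym_def multiaffine_insert[OF assms]
  by (intro arg_cong2[where f = "(+)"] refl arg_cong2[where f = "(*)"] multiaffine_cong)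
    (simp add: card_insert_subset[OF assms])

lemma bonf_insert:
  assumes "finite V" "x \<notin> V"
  shows "bonf (Suc k) (insert x V) h = bonf (Suc k) V h - h x * bonf k V h"
proof -
  have "multiaffine (\<lambda>T. if card (insert x T) \<le> Suc k then (-1) ^ card (insert x T) else 0) V h
      = - bonf k V h"
    unfolding bonf_def multiaffine_def sum_negf[symmetric]
    by (intro sum.cong refl) (simp add: card_insert_subset[OF assms])
  then show ?thesis
    unfolding bonf_def multiaffine_insert[OF assms] by simp
qed

lemma bonf_0: "finite V \<Longrightarrow> bonf 0 V h = 1"
  using esym_0[of V h] unfolding bonf_def esym_def
  by (simp cong: if_cong)

lemma bonf_Suc: "bonf (Suc k) V h = bonf k V h + (-1) ^ Suc k * esym (Suc k) V h"
  unfolding bonf_def esym_def multiaffine_def sum_distrib_left sum.distrib[symmetric]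
  by (intro sum.cong) (auto simp: le_Suc_eq)

text \<open>By \<open>bonf_insert\<close> the error at level \<open>k\<close> is the error for
  \<open>V\<close> plus \<open>h x\<close> times the error at level \<open>k - 1\<close>; the
  alternating sign makes both contributions nonnegative. Real \<open>h\<close> between 0 and 1 is
  allowed because the inequality is applied to densities as well as to indicators.\<close>

lemma bonferroni:
  assumes "finite V" "\<And>x. x \<in> V \<Longrightarrow> 0 \<le> h x \<and> h x \<le> 1"
  shows "0 \<le> (-1) ^ k * (bonf k V h - (\<Prod>x\<in>V. 1 - h x))"
  using assms
proof (induction V arbitrary: k rule: finite_induct)
  case empty
  have "bonf k {} h = 1" by (simp add: bonf_def multiaffine_def)
  then show ?case by simp
next
  case (insert x V)
  show ?case
  proof (cases k)
    case 0
    have "(\<Prod>x\<in>insert x V. 1 - h x) \<le> 1"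
      using insert.prems by (intro prod_le_1) auto
    then show ?thesis using 0 insert.hyps by (simp add: bonf_0)
  next
    case (Suc l)
    let ?P = "\<Prod>x\<in>V. 1 - h x"
    have "(-1) ^ k * (bonf k (insert x V) h - (\<Prod>x\<in>insert x V. 1 - h x)) =
        (-1) ^ k * (bonf k V h - ?P) + h x * ((-1) ^ l * (bonf l V h - ?P))"
      using insert.hyps by (simp add: Suc bonf_insert algebra_simps)
    also have "\<dots> \<ge> 0"
      using insert.IH[of k] insert.IH[of l] insert.prems by auto
    finally show ?thesis .
  qed
qed

text \<open>An even truncation overestimates, the next odd one underestimates, and they differ by a
  single elementary symmetric sum, which thus bounds the excess.\<close>

lemma bonf_even_bounds:
  assumes "finite V" "\<And>x. x \<in> V \<Longrightarrow> 0 \<le> h x \<and> h x \<le> 1" "even k"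
  shows "(\<Prod>x\<in>V. 1 - h x) \<le> bonf k V h"
    and "bonf k V h - (\<Prod>x\<in>V. 1 - h x) \<le> esym (Suc k) V h"
proof -
  have "0 \<le> (-1) ^ i * (bonf i V h - (\<Prod>x\<in>V. 1 - h x))" for i
    by (rule bonferroni[OF assms(1)]) (use assms(2) in auto)
  from this[of k] this[of "Suc k"] show "(\<Prod>x\<in>V. 1 - h x) \<le> bonf k V h"
    and "bonf k V h - (\<Prod>x\<in>V. 1 - h x) \<le> esym (Suc k) V h"
    using assms(3) by (simp_all add: bonf_Suc)
qed

text \<open>Each squarefree monomial of degree \<open>k\<close> occurs \<open>k!\<close> times in
  the expanded power. The induction on \<open>V\<close> needs only the first two terms of the
  binomial expansion.\<close>

lemma esym_le:
  assumes "finite V" "\<And>x. x \<in> V \<Longrightarrow> 0 \<le> h x"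
  shows "esym k V h \<le> sum h V ^ k / fact k"
  using assms
proof (induction V arbitrary: k rule: finite_induct)
  case empty
  show ?case by (cases k) (simp_all add: esym_def multiaffine_def)
next
  case (insert x V)
  show ?case
  proof (cases k)
    case 0
    then show ?thesis using insert.hyps by (simp add: esym_0)
  next
    case (Suc l)
    let ?s = "sum h V"
    have s: "0 \<le> ?s" "0 \<le> h x" using insert.prems by (auto intro: sum_nonneg)
    have "esym k (insert x V) h = esym (Suc l) V h + h x * esym l V h"
      using insert.hyps by (simp add: Suc esym_insert)
    also have "\<dots> \<le> ?s ^ Suc l / fact (Suc l) + h x * (?s ^ l / fact l)"
      using insert.IH[of "Suc l"] insert.IH[of l] insert.prems
      by (intro add_mono mult_left_mono) auto
    also have "h x * (?s ^ l / fact l) = real (Suc l) * ?s ^ l * h x / fact (Suc l)"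
      by (simp add: fact_Suc del: of_nat_Suc)
    also have "?s ^ Suc l / fact (Suc l) + \<dots> =
        (?s ^ Suc l + real (Suc l) * ?s ^ l * h x) / fact (Suc l)"
      by (rule add_divide_distrib[symmetric])
    also have "\<dots> \<le> (?s + h x) ^ Suc l / fact (Suc l)"
    proof (intro divide_right_mono)
      show "?s ^ Suc l + real (Suc l) * ?s ^ l * h x \<le> (?s + h x) ^ Suc l"
      proof (induction l)
        case (Suc i)
        have "?s ^ Suc (Suc i) + real (Suc (Suc i)) * ?s ^ Suc i * h x \<le>
            (?s + h x) * (?s ^ Suc i + real (Suc i) * ?s ^ i * h x)"
          using s by (simp add: algebra_simps)
        also have "\<dots> \<le> (?s + h x) * (?s + h x) ^ Suc i"
          using Suc s by (intro mult_left_mono) auto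
        finally show ?case by simp
      qed simp
    qed simp
    finally show ?thesis using insert.hyps by (simp add: Suc add.commute)
  qed
qed

text \<open>Controls the sieve remainder of one block: the elementary symmetric sums up to level
  \<open>k\<close> are compared term by term with the binomial expansion.\<close>

lemma multiaffine_card_le:
  assumes "finite V" "\<And>x. x \<in> V \<Longrightarrow> 0 \<le> h x" "\<And>T. c T \<le> (if card T \<le> k then 1 else 0)"
  shows "multiaffine c V h \<le> (1 + sum h V) ^ k"
proof -
  have s: "0 \<le> sum h V" using assms(2) by (auto intro: sum_nonneg)
  have "multiaffine c V h \<le> multiaffine (\<lambda>T. if card T \<le> k then 1 else 0) V h"
    unfolding multiaffine_def
    by (intro sum_mono mult_right_mono assms(3) prod_nonneg) (use assms(2) in auto)
  also have "\<dots> = (\<Sum>i\<le>k. esym i V h)"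
    unfolding esym_def multiaffine_def
    by (subst sum.swap) (simp add: sum_distrib_right[symmetric])
  also have "\<dots> \<le> (\<Sum>i\<le>k. real (k choose i) * sum h V ^ i * 1 ^ (k - i))"
  proof (intro sum_mono)
    fix i assume "i \<in> {..k}"
    then have ch: "1 \<le> real (k choose i)"
      by (simp add: Suc_le_eq)
    have "esym i V h \<le> sum h V ^ i / fact i" by (rule esym_le) fact+
    also have "\<dots> \<le> sum h V ^ i / 1"
      using s by (intro divide_left_mono) auto
    also have "\<dots> \<le> real (k choose i) * sum h V ^ i"
      using ch s mult_right_mono[OF ch, of "sum h V ^ i"] by simp
    finally show "esym i V h \<le> real (k choose i) * sum h V ^ i * 1 ^ (k - i)" by simp
  qed
  also have "\<dots> = (1 + sum h V) ^ k"
    using binomial_ring[of "sum h V" 1 k] by (simp add: add.commute)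
  finally show ?thesis .
qed

text \<open>A product of lower bounds is useless when some of them are negative. Here each
  subtracted term contains only one gap \<open>y l - x l\<close>, and all other factors are upper
  bounds; in the induction the product of the \<open>x\<close> is replaced by that of the
  \<open>y\<close> wherever it is multiplied by a gap.\<close>

lemma hooley_inequality:
  fixes x y :: "'a \<Rightarrow> real"
  assumes "finite I" "\<And>i. i \<in> I \<Longrightarrow> 0 \<le> x i \<and> x i \<le> y i"
  shows "prod y I - (\<Sum>l\<in>I. (y l - x l) * prod y (I - {l})) \<le> prod x I"
  using assms
proof (induction I rule: finite_induct)
  case (insert i I)
  have yi: "x i \<le> y i" "0 \<le> y i"
    using insert.prems[of i] by auto
  have le: "prod x I \<le> prod y I" by (intro prod_mono) (use insert.prems in auto)
  have "(\<Sum>l\<in>I. (y l - x l) * prod y (insert i I - {l})) =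
      y i * (\<Sum>l\<in>I. (y l - x l) * prod y (I - {l}))"
    unfolding sum_distrib_left
  proof (intro sum.cong refl)
    fix l assume "l \<in> I"
    then have "insert i I - {l} = insert i (I - {l})" using insert.hyps by auto
    then show "(y l - x l) * prod y (insert i I - {l}) = y i * ((y l - x l) * prod y (I - {l}))"
      using insert.hyps by simp
  qed
  then have "prod y (insert i I) - (\<Sum>l\<in>insert i I. (y l - x l) * prod y (insert i I - {l})) =
      y i * (prod y I - (\<Sum>l\<in>I. (y l - x l) * prod y (I - {l}))) - (y i - x i) * prod y I"
    using insert.hyps by (simp add: algebra_simps)
  also have "\<dots> \<le> y i * prod x I - (y i - x i) * prod y I"
    using mult_left_mono[OF insert.IH yi(2)] insert.prems by simp
  also have "\<dots> \<le> y i * prod x I - (y i - x i) * prod x I"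
    using mult_left_mono[OF le, of "y i - x i"] yi by simp
  also have "\<dots> = prod x (insert i I)"
    using insert.hyps by (simp add: algebra_simps)
  finally show ?case .
qed simp

section \<open>Congruence conditions and primes in dyadic intervals\<close>

lemma diff_dvd_poly_diff: "x - y dvd poly f x - poly f y"
  for x y :: "'a :: comm_ring_1"
proof (induction f)
  case (pCons a f)
  have "poly (pCons a f) x - poly (pCons a f) y = (x - y) * poly f x + y * (poly f x - poly f y)"
    by (simp add: algebra_simps)
  then show ?case using pCons.IH by simp
qed simp

lemma dvd_poly_mod_iff:
  fixes f :: "int poly" and p q n :: nat
  assumes "p dvd q"
  shows "int p dvd poly f (int (n mod q)) \<longleftrightarrow> int p dvd poly f (int n)"
proof -
  have "int n - int (n mod q) = int q * int (n div q)"
    by (simp add: of_nat_mod of_nat_div minus_mod_eq_mult_div)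
  then have "int p dvd int n - int (n mod q)"
    using assms by simp
  then have "int p dvd poly f (int n) - poly f (int (n mod q))"
    using diff_dvd_poly_diff dvd_trans by blast
  then show ?thesis
    by (metis diff_add_cancel dvd_add_right_iff)
qed

section \<open>Roots of an integer polynomial modulo a prime\<close>

definition roots_mod :: "int poly \<Rightarrow> nat \<Rightarrow> nat set" where
  "roots_mod f p = {x. x < p \<and> int p dvd poly f (int x)}"

lemma finite_roots_mod [simp]: "finite (roots_mod f p)"
  by (simp add: roots_mod_def)

text \<open>Lagrange's argument. Nonvanishing modulo \<open>p\<close> is expressed by one value
  prime to \<open>p\<close>, a condition that survives division by \<open>x - a\<close>, because
  \<open>f\<close> and \<open>(x - a) * q\<close> agree modulo \<open>p\<close>. It will be applied
  with \<open>x0 = 0\<close> and value 1.\<close>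

lemma card_roots_mod_le_degree:
  assumes "prime p" "\<not> int p dvd poly f x0"
  shows "card (roots_mod f p) \<le> degree f"
  using assms(2)
proof (induction "degree f" arbitrary: f rule: less_induct)
  case less
  show ?case
  proof (cases "roots_mod f p = {}")
    case False
    then obtain a where a: "a < p" "int p dvd poly f (int a)"
      by (auto simp: roots_mod_def)
    define q where "q = synthetic_div f (int a)"
    have f: "poly f x = (x - int a) * poly q x + poly f (int a)" for x
    proof -
      have "poly f x = poly ([:- int a, 1:] * q + [:poly f (int a):]) x"
        unfolding q_def by (simp only: synthetic_div_correct')
      then show ?thesis by (simp add: algebra_simps)
    qed
    have "degree f \<noteq> 0"
    proof
      assume "degree f = 0"
      then obtain c where "f = [:c:]" by (rule degree_eq_zeroE)
      then show False using a(2) less.prems by simp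
    qed
    moreover have "degree q = degree f - 1"
      unfolding q_def by (rule degree_synthetic_div)
    moreover have "\<not> int p dvd poly q x0"
      using less.prems a(2) f[of x0] by (metis dvd_add dvd_mult)
    ultimately have IH: "card (roots_mod q p) \<le> degree f - 1" "degree f \<ge> 1"
      using less.hyps[of q] by simp_all
    have "roots_mod f p \<subseteq> insert a (roots_mod q p)"
    proof
      fix x assume "x \<in> roots_mod f p"
      then have x: "x < p" "int p dvd poly f (int x)" by (auto simp: roots_mod_def)
      then have "int p dvd (int x - int a) * poly q (int x)"
        using a(2) f[of "int x"] by (metis add.commute dvd_add_right_iff)
      then consider "int p dvd int x - int a" | "int p dvd poly q (int x)"
        using assms(1) by (auto simp: prime_dvd_mult_iff)
      then show "x \<in> insert a (roots_mod q p)"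
      proof cases
        case 1
        then have "int x mod int p = int a mod int p"
          by (simp add: mod_eq_dvd_iff)
        then have "x = a" using x(1) a(1) by simp
        then show ?thesis by simp
      next
        case 2
        then show ?thesis using x(1) by (simp add: roots_mod_def)
      qed
    qed
    then have "card (roots_mod f p) \<le> card (insert a (roots_mod q p))"
      by (intro card_mono) auto
    also have "\<dots> \<le> Suc (card (roots_mod q p))"
      by (simp add: card_insert_if)
    finally show ?thesis using IH by linarith
  qed simp
qed

section \<open>Averages of divisibility conditions over intervals\<close>

lemma sum_periodic:
  fixes f :: "nat \<Rightarrow> real"
  assumes "\<And>n. f (n + q) = f n"
  shows "sum f {a..<a + k * q} = real k * sum f {..<q}"
proof -
  have one: "sum f {a..<a + q} = sum f {..<q}" for a
  proof (induction a)
    case (Suc a)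
    have "f a + sum f {Suc a..<Suc (a + q)} = sum f {a..<Suc (a + q)}"
      by (rule sum.atLeast_Suc_lessThan[symmetric]) simp
    also have "\<dots> = sum f {a..<a + q} + f a"
      using assms by simp
    finally show ?case using Suc by simp
  qed (simp add: atLeast0LessThan)
  show ?thesis
  proof (induction k)
    case (Suc k)
    have split: "sum f {a..<a + Suc k * q} =
        sum f {a..<a + k * q} + sum f {a + k * q..<a + k * q + q}"
      by (subst sum.atLeastLessThan_concat) (auto simp: algebra_simps)
    show ?case unfolding split one Suc by (simp add: algebra_simps)
  qed simp
qed

text \<open>Since \<open>f\<close> is nonnegative, the sum lies between those over \<open>k\<close>
  and \<open>k + 1\<close> full periods, as does its expected value; the discrepancy is at most one
  period.\<close>

lemma sum_periodic_bound:
  fixes f :: "nat \<Rightarrow> real"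
  assumes "\<And>n. f (n + q) = f n" "\<And>n. 0 \<le> f n" "0 < q"
  shows "\<bar>sum f {a..<a + N} - real N * (sum f {..<q} / real q)\<bar> \<le> sum f {..<q}"
proof -
  define k where "k = N div q"
  define s where "s = sum f {..<q}"
  have s: "0 \<le> s" unfolding s_def using assms(2) by (intro sum_nonneg) auto
  have per: "sum f {a..<a + m * q} = real m * s" for m
    unfolding s_def by (rule sum_periodic) (rule assms(1))
  have k: "k * q \<le> N" "N \<le> Suc k * q"
    unfolding k_def using assms(3) dividend_less_div_times[of q N] by (auto simp: add.commute)
  have "sum f {a..<a + k * q} \<le> sum f {a..<a + N}"
    using k assms(2) by (intro sum_mono2) auto
  then have lo: "real k * s \<le> sum f {a..<a + N}"
    by (simp only: per)
  have "sum f {a..<a + N} \<le> sum f {a..<a + Suc k * q}"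
    using k assms(2) by (intro sum_mono2) auto
  then have hi: "sum f {a..<a + N} \<le> real (Suc k) * s"
    by (simp only: per)
  have "real (k * q) \<le> real N" "real N \<le> real (Suc k * q)"
    using k by (simp_all only: of_nat_le_iff)
  then have "real k \<le> real N / real q" "real N / real q \<le> real (Suc k)"
    using assms(3) by (simp_all add: field_simps)
  then have "real k * s \<le> real N / real q * s" "real N / real q * s \<le> real (Suc k) * s"
    using s by (blast intro: mult_right_mono)+
  with lo hi show ?thesis
    unfolding s_def[symmetric] by (simp add: algebra_simps abs_le_iff)
qed

lemma sum_chinese_remainder:
  fixes f g :: "nat \<Rightarrow> real"
  assumes "coprime p q" "0 < p" "0 < q"
  shows "(\<Sum>x<p * q. f (x mod p) * g (x mod q)) = sum f {..<p} * sum g {..<q}"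
proof -
  have "bij_betw (\<lambda>x. (x mod p, x mod q)) {..<p * q} ({..<p} \<times> {..<q})"
  proof (rule bij_betwI')
    fix x y assume xy: "x \<in> {..<p * q}" "y \<in> {..<p * q}"
    have "\<exists>!z. z < p * q \<and> [z = x] (mod p) \<and> [z = x] (mod q)"
      using assms by (intro binary_chinese_remainder_unique_nat) auto
    with xy show "((x mod p, x mod q) = (y mod p, y mod q)) = (x = y)"
      unfolding cong_def by (metis lessThan_iff prod.inject)
  next
    fix z assume "z \<in> {..<p} \<times> {..<q}"
    then obtain u v where z: "z = (u, v)" "u < p" "v < q" by auto
    obtain x where "x < p * q" "[x = u] (mod p)" "[x = v] (mod q)"
      using assms binary_chinese_remainder_unique_nat[of p q u v] by auto
    then show "\<exists>x\<in>{..<p * q}. z = (x mod p, x mod q)"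
      using z by (auto simp: cong_def)
  qed (use assms in auto)
  from sum.reindex_bij_betw[OF this, of "\<lambda>(x, y). f x * g y"]
  show ?thesis by (simp add: sum_product sum.cartesian_product)
qed

definition divides_value :: "int poly \<Rightarrow> nat \<Rightarrow> nat \<Rightarrow> real" where
  "divides_value f n p = of_bool (int p dvd poly f (int n))"

lemma divides_value_mod: "p dvd q \<Longrightarrow> divides_value f (n mod q) p = divides_value f n p"
  by (simp add: divides_value_def dvd_poly_mod_iff)

lemma prod_divides_value_mod:
  assumes "finite T"
  shows "prod (divides_value f (n mod \<Prod>T)) T = prod (divides_value f n) T"
  using dvd_prodI[OF assms, where f = "\<lambda>p. p"]
  by (intro prod.cong refl divides_value_mod) auto

lemma sum_divides_value:
  "(\<Sum>x<p. divides_value f x p) = card (roots_mod f p)"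
  unfolding divides_value_def roots_mod_def
  by (simp add: of_bool_def sum.If_cases Int_def)

lemma sum_prod_divides_value:
  assumes "finite T" "\<And>p. p \<in> T \<Longrightarrow> prime p"
  shows "(\<Sum>x<\<Prod>T. prod (divides_value f x) T) = (\<Prod>p\<in>T. real (card (roots_mod f p)))"
  using assms
proof (induction T rule: finite_induct)
  case (insert p T)
  have cop: "coprime p (\<Prod>T)"
    using insert by (intro prod_coprime_right) (auto intro!: primes_coprime)
  have pos: "0 < \<Prod>T" "0 < p"
    using insert.prems prime_gt_0_nat by (auto intro!: prod_pos)
  have "(\<Sum>x<\<Prod>(insert p T). prod (divides_value f x) (insert p T)) =
      (\<Sum>x<p * \<Prod>T. divides_value f (x mod p) p * prod (divides_value f (x mod \<Prod>T)) T)"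
    using insert.hyps by (simp add: divides_value_mod prod_divides_value_mod)
  also have "\<dots> = (\<Sum>x<p. divides_value f x p) * (\<Sum>x<\<Prod>T. prod (divides_value f x) T)"
    using cop pos by (intro sum_chinese_remainder) auto
  finally show ?case
    using insert by (simp add: sum_divides_value)
qed simp

text \<open>Divisibility by all primes of \<open>T\<close> is periodic modulo their product, and the
  Chinese remainder theorem factors the count in one period. This supplies the hypothesis
  \<open>avg\<close> of the sieve.\<close>

lemma divides_value_average:
  assumes "finite T" "\<And>p. p \<in> T \<Longrightarrow> prime p"
  shows "\<bar>(\<Sum>n\<in>{a..<a + N}. prod (divides_value f n) T) -
      real N * (\<Prod>p\<in>T. real (card (roots_mod f p)) / real p)\<bar>
    \<le> (\<Prod>p\<in>T. real (card (roots_mod f p)))"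
proof -
  have "prod (divides_value f (n + \<Prod>T)) T = prod (divides_value f n) T" for n
    using prod_divides_value_mod[OF assms(1)] by (metis mod_add_self2)
  moreover have "0 \<le> prod (divides_value f n) T" for n
    by (intro prod_nonneg) (simp add: divides_value_def)
  moreover have "0 < \<Prod>T"
    using assms prime_gt_0_nat by (auto intro!: prod_pos)
  ultimately have "\<bar>(\<Sum>n\<in>{a..<a + N}. prod (divides_value f n) T) -
      real N * ((\<Sum>x<\<Prod>T. prod (divides_value f x) T) / real (\<Prod>T))\<bar>
    \<le> (\<Sum>x<\<Prod>T. prod (divides_value f x) T)"
    by (rule sum_periodic_bound)
  then show ?thesis
    by (simp add: sum_prod_divides_value[OF assms] prod_dividef)
qed

section \<open>Chebyshev's upper bound for primes\<close>

lemma prod_primes_dvd: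
  assumes "finite S" "\<And>p. p \<in> S \<Longrightarrow> prime p" "\<And>p. p \<in> S \<Longrightarrow> p dvd m"
  shows "\<Prod>S dvd (m :: nat)"
  using assms
proof (induction S rule: finite_induct)
  case (insert p S)
  then have "coprime p (\<Prod>S)"
    by (intro prod_coprime_right) (auto intro!: primes_coprime)
  with insert show ?case by (simp add: divides_mult)
qed simp

text \<open>With \<open>n = 2 ^ k\<close>, all primes in the interval divide the central binomial
  coefficient, which is at most \<open>4 ^ n\<close>, while each of them exceeds
  \<open>n\<close>.\<close>

lemma card_primes_dyadic:
  "card {p::nat. prime p \<and> 2 ^ k < p \<and> p \<le> 2 ^ Suc k} * k \<le> 2 ^ Suc k"
proof -
  define S where "S = {p::nat. prime p \<and> 2 ^ k < p \<and> p \<le> 2 ^ Suc k}"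
  define n where "n = (2::nat) ^ k"
  have fin: "finite S"
    unfolding S_def by (rule finite_subset[of _ "{..2 ^ Suc k}"]) auto
  have "p dvd (2 * n choose n)" if "p \<in> S" for p
  proof -
    have p: "prime p" "n < p" "p \<le> 2 * n" using that by (auto simp: S_def n_def)
    have "p dvd fact n * fact n * (2 * n choose n)"
      using p binomial_fact_lemma[of n "2 * n"] by (simp add: mult_2 prime_dvd_fact_iff)
    then show ?thesis
      using p by (simp add: prime_dvd_mult_iff prime_dvd_fact_iff)
  qed
  then have "\<Prod>S dvd (2 * n choose n)"
    using fin by (intro prod_primes_dvd) (auto simp: S_def)
  then have "\<Prod>S \<le> (2 * n choose n)"
    by (rule dvd_imp_le) (simp add: zero_less_binomial)
  also have "\<dots> \<le> 2 ^ (2 * n)" by (rule binomial_le_pow2)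
  finally have "\<Prod>S \<le> 2 ^ (2 * n)" .
  moreover have "n ^ card S \<le> \<Prod>S"
    unfolding prod_constant[symmetric] by (rule prod_mono) (auto simp: S_def n_def)
  ultimately have "(2::nat) ^ (k * card S) \<le> 2 ^ (2 * n)"
    unfolding n_def by (simp add: power_mult)
  then have "k * card S \<le> 2 * n" by simp
  then show ?thesis by (simp add: S_def n_def mult.commute)
qed

text \<open>Each dyadic interval contributes at most \<open>2 / a\<close>. This weak form of
  Mertens' theorem suffices: it is used with \<open>b = a\<close>, where the bound is the constant
  2.\<close>

lemma sum_inverse_primes_le:
  assumes "0 < a"
  shows "(\<Sum>p | prime p \<and> 2 ^ a < p \<and> p \<le> 2 ^ (a + b). 1 / real p) \<le> real b * (2 / real a)"
proof (induction b)
  case (Suc b)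
  define k where "k = a + b"
  let ?S = "{p::nat. prime p \<and> 2 ^ k < p \<and> p \<le> 2 ^ Suc k}"
  have fin: "finite {p::nat. prime p \<and> 2 ^ u < p \<and> p \<le> 2 ^ v}" for u v
    by (rule finite_subset[of _ "{..2 ^ v}"]) auto
  have "{p::nat. prime p \<and> x < p \<and> p \<le> z} =
      {p. prime p \<and> x < p \<and> p \<le> y} \<union> {p. prime p \<and> y < p \<and> p \<le> z}"
    if "x \<le> y" "y \<le> z" for x y z
    using that by auto
  then have "{p::nat. prime p \<and> 2 ^ a < p \<and> p \<le> 2 ^ Suc k} =
      {p. prime p \<and> 2 ^ a < p \<and> p \<le> 2 ^ k} \<union> ?S"
    by (simp add: k_def)
  then have "(\<Sum>p | prime p \<and> 2 ^ a < p \<and> p \<le> 2 ^ Suc k. 1 / real p) =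
      (\<Sum>p | prime p \<and> 2 ^ a < p \<and> p \<le> 2 ^ k. 1 / real p) + (\<Sum>p\<in>?S. 1 / real p)"
    using fin by (simp only:) (rule sum.union_disjoint, auto)
  moreover have "(\<Sum>p\<in>?S. 1 / real p) \<le> (\<Sum>p\<in>?S. 1 / 2 ^ k)"
  proof (intro sum_mono divide_left_mono)
    fix p assume "p \<in> ?S"
    then have "2 ^ k \<le> p" "0 < p" by (auto simp: prime_gt_0_nat)
    then have "real (2 ^ k) \<le> real p" "0 < real p" by (simp_all only: of_nat_le_iff of_nat_0_less_iff)
    then show "2 ^ k \<le> real p" "0 < real p * 2 ^ k" by simp_all
  qed simp
  moreover have "(\<Sum>p\<in>?S. 1 / 2 ^ k) \<le> 2 / real k"
  proof -
    have "real (card ?S * k) \<le> real (2 ^ Suc k)"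
      using card_primes_dyadic[of k] by (simp only: of_nat_le_iff)
    then have "real (card ?S) * real k \<le> 2 * 2 ^ k" by simp
    moreover have "0 < real k" using assms by (simp add: k_def)
    ultimately show ?thesis by (simp add: field_simps)
  qed
  moreover have "2 / real k \<le> 2 / real a"
    using assms by (intro divide_left_mono) (auto simp: k_def)
  moreover have "real (Suc b) * (2 / real a) = real b * (2 / real a) + 2 / real a"
    by (simp add: add_divide_distrib)
  ultimately have "(\<Sum>p | prime p \<and> 2 ^ a < p \<and> p \<le> 2 ^ Suc k. 1 / real p) \<le> real (Suc b) * (2 / real a)"
    using Suc[folded k_def] by linarith
  then show ?case by (simp add: k_def)
qed (auto intro!: sum_nonpos)

section \<open>The Brun-Hooley sieve\<close>

text \<open>The requirement \<open>h p <= 1/2\<close> is what forces the sieve to start above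
  \<open>2 * D\<close>, as there may be \<open>D\<close> roots modulo \<open>p\<close>.\<close>

lemma exp_le_prod_one_minus:
  assumes "finite V" "\<And>p. p \<in> V \<Longrightarrow> 0 \<le> h p \<and> h p \<le> (1/2 :: real)"
  shows "exp (- 2 * sum h V) \<le> (\<Prod>p\<in>V. 1 - h p)"
proof -
  have "exp (- 2 * h p) \<le> 1 - h p" if "p \<in> V" for p
  proof -
    have hp: "0 \<le> h p" "h p \<le> 1/2" using assms(2)[OF that] by auto
    have "0 \<le> h p * (1 - 2 * h p)" using hp by (intro mult_nonneg_nonneg) auto
    then have "1 \<le> (1 - h p) * (1 + 2 * h p)" by (simp add: algebra_simps)
    also have "\<dots> \<le> (1 - h p) * exp (2 * h p)"
      using hp exp_ge_add_one_self[of "2 * h p"] by (intro mult_left_mono) auto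
    finally show ?thesis by (simp add: exp_minus field_simps)
  qed
  then have "(\<Prod>p\<in>V. exp (- 2 * h p)) \<le> (\<Prod>p\<in>V. 1 - h p)"
    by (intro prod_mono) auto
  then show ?thesis
    using assms(1) by (simp add: exp_sum[symmetric] sum_distrib_left sum_negf)
qed

text \<open>
  Here \<open>f a p\<close> indicates that \<open>p\<close> sifts out \<open>a\<close>, \<open>h p\<close> is the density of this event and \<open>\<rho>\<close> bounds the
  errors. The truncation levels \<open>k j\<close> are even, so that the truncated sums are upper bounds in each
  block, which is what Hooley's inequality needs.
\<close>

lemma brun_hooley_sieve:
  fixes f :: "'n \<Rightarrow> 'p \<Rightarrow> real" and U :: "nat \<Rightarrow> 'p set"
  assumes fin: "\<And>j. finite (U j)" and disj: "disjoint_family_on U {..<J}"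
    and f: "\<And>a p. 0 \<le> f a p \<and> f a p \<le> 1"
    and h: "\<And>j p. p \<in> U j \<Longrightarrow> 0 \<le> h p \<and> h p \<le> 1/2"
    and \<rho>: "\<And>j p. p \<in> U j \<Longrightarrow> 0 \<le> \<rho> p"
    and N: "0 \<le> N"
    and avg: "\<And>T. T \<subseteq> (\<Union>j<J. U j) \<Longrightarrow> \<bar>(\<Sum>a\<in>A. prod (f a) T) - N * prod h T\<bar> \<le> prod \<rho> T"
    and k: "\<And>j. even (k j)"
    and L: "\<And>j. j < J \<Longrightarrow> sum h (U j) \<le> L"
    and tail: "(\<Sum>j<J. L ^ Suc (k j) / fact (Suc (k j))) \<le> exp (- 2 * L) / 2"
    and E: "(\<Prod>j<J. (1 + sum \<rho> (U j)) ^ Suc (k j)) \<le> E"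
  shows "N * exp (- 2 * L) ^ J / 2 - (1 + real J) * E \<le> (\<Sum>a\<in>A. \<Prod>j<J. \<Prod>p\<in>U j. 1 - f a p)"
proof -
  define c where "c j T = (if card T \<le> k j then (-1) ^ card T else 0 :: real)" for j and T :: "'p set"
  define d where "d j T = (if card T = Suc (k j) then 1 else 0 :: real)" for j and T :: "'p set"
  define x where "x a j = (\<Prod>p\<in>U j. 1 - f a p)" for a j
  define y where "y g j = bonf (k j) (U j) g" for g j
  define e where "e g j = esym (Suc (k j)) (U j) g" for g j
  define v where "v = exp (- 2 * L)"
  have v: "0 < v" by (simp add: v_def)

  \<comment> \<open>One estimate for all weights that occur: the product of the \<open>y\<close>,
    and the same product with one factor replaced by \<open>e\<close>. The level is
    \<open>Suc (k j)\<close> because \<open>e\<close> involves subsets of that size.\<close>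
  have estimate: "\<bar>(\<Sum>a\<in>A. \<Prod>j<J. multiaffine (q j) (U j) (f a)) - N * (\<Prod>j<J. multiaffine (q j) (U j) h)\<bar> \<le> E"
    if q: "\<And>j T. \<bar>q j T\<bar> \<le> (if card T \<le> Suc (k j) then 1 else 0)" for q
  proof -
    let ?Q = "\<lambda>T. \<Prod>j<J. q j (T \<inter> U j)" and ?V = "\<Union>j<J. U j"
    have mp: "(\<Prod>j<J. multiaffine (r j) (U j) g) = multiaffine (\<lambda>T. \<Prod>j<J. r j (T \<inter> U j)) ?V g" for r g
      using fin disj by (intro multiaffine_prod) auto
    have "\<bar>(\<Sum>a\<in>A. multiaffine ?Q ?V (f a)) - N * multiaffine ?Q ?V h\<bar> \<le> multiaffine (\<lambda>T. \<bar>?Q T\<bar>) ?V \<rho>"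
      by (rule multiaffine_average) (rule avg)
    also have "\<dots> = (\<Prod>j<J. multiaffine (\<lambda>T. \<bar>q j T\<bar>) (U j) \<rho>)"
      unfolding mp abs_prod ..
    also have "\<dots> \<le> (\<Prod>j<J. (1 + sum \<rho> (U j)) ^ Suc (k j))"
    proof (intro prod_mono conjI)
      fix j assume "j \<in> {..<J}"
      show "0 \<le> multiaffine (\<lambda>T. \<bar>q j T\<bar>) (U j) \<rho>"
        unfolding multiaffine_def using \<rho> by (intro sum_nonneg mult_nonneg_nonneg prod_nonneg) auto
      show "multiaffine (\<lambda>T. \<bar>q j T\<bar>) (U j) \<rho> \<le> (1 + sum \<rho> (U j)) ^ Suc (k j)"
        using fin \<rho> q by (intro multiaffine_card_le) auto
    qed
    finally show ?thesis using E unfolding mp by linarith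
  qed

  have y_eq: "y g j = multiaffine (c j) (U j) g" for g j
    by (simp add: y_def bonf_def c_def[abs_def])
  have prod_y: "\<bar>(\<Sum>a\<in>A. prod (y (f a)) {..<J}) - N * prod (y h) {..<J}\<bar> \<le> E"
    unfolding y_eq by (rule estimate) (auto simp: c_def)
  have prod_e: "\<bar>(\<Sum>a\<in>A. e (f a) l * prod (y (f a)) ({..<J} - {l})) -
      N * (e h l * prod (y h) ({..<J} - {l}))\<bar> \<le> E" if "l < J" for l
  proof -
    define q where "q = c(l := d l)"
    have "(\<Prod>j<J. multiaffine (q j) (U j) g) = e g l * prod (y g) ({..<J} - {l})" for g
    proof -
      have "(\<Prod>j\<in>{..<J} - {l}. multiaffine (q j) (U j) g) = prod (y g) ({..<J} - {l})"
        by (intro prod.cong) (auto simp: q_def y_eq)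
      moreover have "multiaffine (q l) (U l) g = e g l"
        by (simp add: q_def e_def esym_def d_def[abs_def])
      ultimately show ?thesis using that by (simp add: prod.remove[of "{..<J}" l])
    qed
    moreover have "\<bar>q j T\<bar> \<le> (if card T \<le> Suc (k j) then 1 else 0)" for j T
      by (auto simp: q_def c_def d_def)
    ultimately show ?thesis using estimate[of q] by simp
  qed

  have xy: "0 \<le> x a j" "x a j \<le> y (f a) j" "y (f a) j - x a j \<le> e (f a) j" for a j
  proof -
    show "0 \<le> x a j" unfolding x_def by (intro prod_nonneg) (use f in auto)
    show "x a j \<le> y (f a) j" "y (f a) j - x a j \<le> e (f a) j"
      unfolding x_def y_def e_def using fin f k by (auto intro!: bonf_even_bounds)
  qed
  \<comment> \<open>Hooley's inequality for each \<open>a\<close>. The gap \<open>y - x\<close>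
    involves subsets of all sizes, so it is replaced by \<open>e\<close>, whose average is covered
    by \<open>estimate\<close>.\<close>
  have "prod (y (f a)) {..<J} - (\<Sum>l<J. e (f a) l * prod (y (f a)) ({..<J} - {l})) \<le> prod (x a) {..<J}" for a
  proof -
    have "(\<Sum>l<J. (y (f a) l - x a l) * prod (y (f a)) ({..<J} - {l})) \<le>
        (\<Sum>l<J. e (f a) l * prod (y (f a)) ({..<J} - {l}))"
      using xy order_trans[OF xy(1,2)] by (intro sum_mono mult_right_mono prod_nonneg) auto
    moreover have "prod (y (f a)) {..<J} - (\<Sum>l<J. (y (f a) l - x a l) * prod (y (f a)) ({..<J} - {l}))
        \<le> prod (x a) {..<J}"
      using xy by (intro hooley_inequality) auto
    ultimately show ?thesis by linarith
  qed
  then have "(\<Sum>a\<in>A. prod (y (f a)) {..<J} - (\<Sum>l<J. e (f a) l * prod (y (f a)) ({..<J} - {l})))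
      \<le> (\<Sum>a\<in>A. prod (x a) {..<J})"
    by (intro sum_mono)
  moreover have "(\<Sum>a\<in>A. prod (y (f a)) {..<J} - (\<Sum>l<J. e (f a) l * prod (y (f a)) ({..<J} - {l}))) =
      (\<Sum>a\<in>A. prod (y (f a)) {..<J}) - (\<Sum>l<J. \<Sum>a\<in>A. e (f a) l * prod (y (f a)) ({..<J} - {l}))"
    unfolding sum_subtractf by (subst (2) sum.swap) simp
  moreover have "(\<Sum>l<J. \<Sum>a\<in>A. e (f a) l * prod (y (f a)) ({..<J} - {l})) \<le>
      (\<Sum>l<J. N * (e h l * prod (y h) ({..<J} - {l})) + E)"
    using prod_e by (intro sum_mono) (auto simp: abs_le_iff algebra_simps)
  moreover have "N * prod (y h) {..<J} - E \<le> (\<Sum>a\<in>A. prod (y (f a)) {..<J})"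
    using prod_y by (simp add: abs_le_iff)
  \<comment> \<open>One error \<open>E\<close> comes from the main product and one from each of the
    \<open>J\<close> correction terms.\<close>
  ultimately have lower: "N * (prod (y h) {..<J} - (\<Sum>l<J. e h l * prod (y h) ({..<J} - {l}))) - (1 + real J) * E
      \<le> (\<Sum>a\<in>A. prod (x a) {..<J})"
    by (simp add: sum.distrib sum_distrib_left algebra_simps)

  have vy: "v \<le> y h j" if "j < J" for j
  proof -
    have "v \<le> exp (- 2 * sum h (U j))" using L[OF that] by (simp add: v_def)
    also have "\<dots> \<le> (\<Prod>p\<in>U j. 1 - h p)"
      using fin h by (intro exp_le_prod_one_minus) auto
    also have "\<dots> \<le> y h j"
      unfolding y_def
    proof (rule bonf_even_bounds(1)[OF fin _ k])
      show "0 \<le> h p \<and> h p \<le> 1" if "p \<in> U j" for p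
        using h[OF that] by simp
    qed
    finally show ?thesis .
  qed
  \<comment> \<open>Inserting the factor \<open>y h l / v\<close>, which is at least 1, turns each
    correction term into a multiple of the full product; \<open>tail\<close> then says that together
    they consume at most half of it.\<close>
  have e_le: "e h l * prod (y h) ({..<J} - {l}) \<le>
      L ^ Suc (k l) / fact (Suc (k l)) / v * prod (y h) {..<J}" if "l < J" for l
  proof -
    let ?t = "L ^ Suc (k l) / fact (Suc (k l))"
    have s: "0 \<le> sum h (U l)" using h by (intro sum_nonneg) auto
    have "e h l \<le> sum h (U l) ^ Suc (k l) / fact (Suc (k l))"
      unfolding e_def using fin h by (intro esym_le) auto
    also have "\<dots> \<le> ?t"
      using s L[OF that] by (intro divide_right_mono power_mono) auto
    finally have e: "e h l \<le> ?t" .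
    have t: "0 \<le> ?t" using s L[OF that] by simp
    have "?t * 1 \<le> ?t * (y h l / v)"
      using v vy[OF that] t by (intro mult_left_mono) auto
    then have "e h l \<le> ?t / v * y h l" using e by simp
    moreover have "0 \<le> prod (y h) ({..<J} - {l})"
      using v vy by (intro prod_nonneg) (auto intro: order_trans less_imp_le)
    ultimately have "e h l * prod (y h) ({..<J} - {l}) \<le> ?t / v * y h l * prod (y h) ({..<J} - {l})"
      by (intro mult_right_mono)
    then show ?thesis using that by (simp add: prod.remove[of "{..<J}" l] mult.assoc)
  qed
  have P: "v ^ J \<le> prod (y h) {..<J}"
    using v vy prod_mono[of "{..<J}" "\<lambda>_. v" "y h"] by simp
  have "(\<Sum>l<J. e h l * prod (y h) ({..<J} - {l})) \<le>
      (\<Sum>l<J. L ^ Suc (k l) / fact (Suc (k l)) / v * prod (y h) {..<J})"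
    using e_le by (intro sum_mono) auto
  also have "\<dots> = (\<Sum>l<J. L ^ Suc (k l) / fact (Suc (k l))) / v * prod (y h) {..<J}"
    by (simp only: sum_distrib_right sum_divide_distrib)
  also have "\<dots> \<le> (v / 2) / v * prod (y h) {..<J}"
    using tail v order_trans[OF zero_le_power[OF less_imp_le[OF v]] P] unfolding v_def[symmetric]
    by (intro mult_right_mono divide_right_mono) auto
  also have "\<dots> = prod (y h) {..<J} / 2" using v by simp
  finally have "v ^ J / 2 \<le> prod (y h) {..<J} - (\<Sum>l<J. e h l * prod (y h) ({..<J} - {l}))"
    using P by linarith
  from mult_left_mono[OF this N] lower show ?thesis
    by (simp add: v_def x_def)
qed

text \<open>The exponent, in units of \<open>w\<close>, of the sieve error: block \<open>j\<close>
  contributes the square of \<open>2 ^ (w * 2 ^ Suc j)\<close> to the power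
  \<open>2 * (b + J - 1 - j) + 1\<close>. Counted down from the top block, geometric decay beats
  linear growth. Peeling off the top block shifts \<open>b\<close> by one, hence the generalisation
  over \<open>b\<close>.\<close>

lemma block_exponent_sum:
  "(\<Sum>j<J. 2 ^ Suc j * (4 * (b + J - 1 - j) + 2)) \<le> (2::nat) ^ J * (8 * b + 12)"
proof (induction J arbitrary: b)
  case (Suc J)
  have "(\<Sum>j<Suc J. 2 ^ Suc j * (4 * (b + Suc J - 1 - j) + 2)) =
      (\<Sum>j<J. 2 ^ Suc j * (4 * (Suc b + J - 1 - j) + 2)) + 2 ^ Suc J * (4 * b + 2)"
    by simp
  also have "\<dots> \<le> 2 ^ J * (8 * Suc b + 12) + 2 ^ Suc J * (4 * b + 2)"
    using Suc[of "Suc b"] by (rule add_right_mono)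
  also have "\<dots> = 2 ^ Suc J * (8 * b + 12)" by (simp add: algebra_simps)
  finally show ?case .
qed simp

lemma ex_power_over_fact_le:
  assumes "0 < (v::real)"
  obtains b :: nat where "\<And>k. b \<le> k \<Longrightarrow> x ^ k / fact k \<le> v"
proof -
  have "(\<lambda>k. inverse (fact k) * x ^ k) \<longlonglongrightarrow> 0"
    by (rule summable_LIMSEQ_zero[OF summable_exp])
  then have "\<forall>\<^sub>F k in sequentially. inverse (fact k) * x ^ k < v"
    using assms by (rule order_tendstoD)
  then obtain b where "\<And>k. b \<le> k \<Longrightarrow> inverse (fact k) * x ^ k < v"
    unfolding eventually_sequentially by blast
  then show ?thesis
    by (intro that[of b]) (simp add: divide_inverse mult.commute less_imp_le)
qed

text \<open>Assuming the bound for \<open>2 * L\<close> instead of \<open>L\<close> gains a factor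
  \<open>(1/2) ^ m\<close> in each term, and the resulting geometric series stays below
  \<open>v / 2\<close>.\<close>

lemma tail_sum_le:
  fixes L v :: real
  assumes "0 \<le> L" "0 < v" "\<And>k. b \<le> k \<Longrightarrow> (2 * L) ^ k / fact k \<le> v" "1 \<le> b"
  shows "(\<Sum>j<J. L ^ Suc (2 * (b + J - 1 - j)) / fact (Suc (2 * (b + J - 1 - j)))) \<le> v / 2"
proof -
  have "(\<Sum>j<J. L ^ Suc (2 * (b + J - 1 - j)) / fact (Suc (2 * (b + J - 1 - j)))) \<le>
      (\<Sum>j<J. v * (1 / 2) ^ (J - Suc j + 2))"
  proof (intro sum_mono)
    fix j assume "j \<in> {..<J}"
    then have j: "j < J" by simp
    define m where "m = Suc (2 * (b + J - 1 - j))"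
    have m: "b \<le> m" "J - Suc j + 2 \<le> m" using j assms(4) by (auto simp: m_def)
    have "L ^ m / fact m = (2 * L) ^ m / fact m * (1 / 2) ^ m"
      by (simp add: power_mult_distrib power_divide)
    also have "\<dots> \<le> v * (1 / 2) ^ (J - Suc j + 2)"
      using assms m by (intro mult_mono power_decreasing) auto
    finally show "L ^ Suc (2 * (b + J - 1 - j)) / fact (Suc (2 * (b + J - 1 - j)))
        \<le> v * (1 / 2) ^ (J - Suc j + 2)"
      unfolding m_def .
  qed
  also have "\<dots> = v * (\<Sum>i<J. (1 / 2) ^ (i + 2))"
    unfolding sum_distrib_left
    by (rule sum.nat_diff_reindex[of "\<lambda>i. v * (1 / 2) ^ (i + 2)"])
  also have "(\<Sum>i<J. (1 / 2 :: real) ^ (i + 2)) = 1 / 2 - (1 / 2) ^ Suc J"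
    by (induction J) (simp_all add: field_simps)
  also have "v * (1 / 2 - (1 / 2) ^ Suc J) \<le> v * (1 / 2)"
    using assms(2) by (intro mult_left_mono) auto
  finally show ?thesis by simp
qed

text \<open>Main term against error in the sieve: their ratio gains a doubly exponential factor in
  the number \<open>J\<close> of blocks, while each block costs only a constant factor.\<close>

lemma eventually_double_exponential:
  "\<forall>\<^sub>F J in sequentially. 2 * (1 + real J) < 2 ^ (2 ^ J) * exp (- a) ^ J"
proof -
  have "\<forall>\<^sub>F J in sequentially. 2 * (1 + real J) < 2 powr (2 powr real J) * exp (- a * real J)"
    by real_asymp
  then show ?thesis
    by eventually_elim (simp add: powr_realpow[symmetric] exp_of_nat_mult[symmetric] mult.commute)
qed

text \<open>
  The end points of consecutive blocks of primes are squares of each other, so each block has bounded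
  \<open>\<Sum> 1/p\<close>. The truncation level grows linearly from the top block down: fast enough for the tail to
  be summable, slowly enough for the total level of distribution to stay a fixed power of the
  largest prime.
\<close>

lemma eventually_no_medium_prime_factor:
  fixes D :: nat
  assumes "1 \<le> D"
  obtains w B :: nat where "1 \<le> w" "1 \<le> B" "\<And>g. degree g \<le> D \<Longrightarrow> poly g 0 = 1 \<Longrightarrow>
    \<forall>\<^sub>F J in sequentially. \<exists>n\<in>{2 ^ (w * 2 ^ J * B)..<2 * 2 ^ (w * 2 ^ J * B)}.
      \<forall>p. prime p \<longrightarrow> 2 ^ w < p \<longrightarrow> p \<le> 2 ^ (w * 2 ^ J) \<longrightarrow> \<not> int p dvd poly g (int n)"
proof -
  \<comment> \<open>At most \<open>D\<close> roots modulo each prime, times the bound 2 for the sum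
    of \<open>1/p\<close> over a block.\<close>
  define L where "L = 2 * real D"
  define v where "v = exp (- 2 * L)"
  \<comment> \<open>Ensures \<open>2 * D <= 2 ^ w\<close>, so that all sieving densities are at most
    1/2.\<close>
  define w where "w = 2 * D"
  have "0 < v" by (simp add: v_def)
  then obtain b0 where b0: "\<And>k. b0 \<le> k \<Longrightarrow> (2 * L) ^ k / fact k \<le> v"
    using ex_power_over_fact_le by blast
  define b where "b = max 1 b0"
  \<comment> \<open>One more than the \<open>8 * b + 12\<close> of
    \<open>block_exponent_sum\<close>, so that the interval length exceeds the error
    \<open>E\<close> by the factor \<open>2 ^ (w * 2 ^ J)\<close>.\<close>
  define B where "B = 8 * b + 13"
  have Dw: "2 * D \<le> 2 ^ w"
    unfolding w_def by (rule less_imp_le[OF less_exp])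
  have "\<forall>\<^sub>F J in sequentially. \<exists>n\<in>{2 ^ (w * 2 ^ J * B)..<2 * 2 ^ (w * 2 ^ J * B)}.
      \<forall>p. prime p \<longrightarrow> 2 ^ w < p \<longrightarrow> p \<le> 2 ^ (w * 2 ^ J) \<longrightarrow> \<not> int p dvd poly g (int n)"
    if g: "degree g \<le> D" "poly g 0 = 1" for g
    using eventually_double_exponential[of "2 * L"]
  proof eventually_elim
    case (elim J)
    define z where "z j = (2::nat) ^ (w * 2 ^ j)" for j
    define N where "N = (2::nat) ^ (w * 2 ^ J * B)"
    define U where "U j = {p. prime p \<and> z j < p \<and> p \<le> z (Suc j)}" for j
    define k where "k j = 2 * (b + J - 1 - j)" for j
    define \<rho> where "\<rho> p = real (card (roots_mod g p))" for p
    define E where "E = (2::real) ^ (w * (2 ^ J * (8 * b + 12)))"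
    have z_mono: "z i \<le> z j" if "i \<le> j" for i j
      unfolding z_def using that by (intro power_increasing mult_left_mono) auto
    have z0: "2 ^ w \<le> z j" for j
      using z_mono[of 0 j] by (simp add: z_def)
    have U: "prime p" "z j < p" "p \<le> z (Suc j)" "2 * D \<le> p" if "p \<in> U j" for p j
      using that z0[of j] Dw by (auto simp: U_def)
    have finU: "finite (U j)" for j
      by (rule finite_subset[of _ "{..z (Suc j)}"]) (auto simp: U_def)
    have \<rho>: "0 \<le> \<rho> p" "\<rho> p \<le> real D" if "prime p" for p
    proof -
      have "\<not> int p dvd poly g 0"
        using g(2) that by (auto simp: prime_nat_iff)
      then show "\<rho> p \<le> real D"
        using card_roots_mod_le_degree[OF that] g(1) by (fastforce simp: \<rho>_def)
    qed (simp add: \<rho>_def)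
    have "N * exp (- 2 * L) ^ J / 2 - (1 + real J) * E
        \<le> (\<Sum>n\<in>{N..<N + N}. \<Prod>j<J. \<Prod>p\<in>U j. 1 - divides_value g n p)"
    proof (rule brun_hooley_sieve[where h = "\<lambda>p. \<rho> p / real p" and \<rho> = \<rho> and k = k])
      show "disjoint_family_on U {..<J}"
      proof -
        have "U i \<inter> U j = {}" if "i < j" for i j
          using z_mono[of "Suc i" j] that by (auto simp: U_def)
        then show ?thesis
          unfolding disjoint_family_on_def by (metis Int_commute linorder_neqE_nat)
      qed
      show "0 \<le> divides_value g n p \<and> divides_value g n p \<le> 1" for n p
        by (simp add: divides_value_def)
      show "0 \<le> \<rho> p / real p \<and> \<rho> p / real p \<le> 1 / 2" if "p \<in> U j" for p j
      proof -
        have "2 * real D \<le> real p" "0 < real p"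
          using U[OF that] prime_gt_0_nat[of p] by (simp_all only: of_nat_le_iff[symmetric] of_nat_mult of_nat_numeral of_nat_0_less_iff)
        then show ?thesis using \<rho>[OF U(1)[OF that]] by (simp add: field_simps)
      qed
      show "\<bar>(\<Sum>n\<in>{N..<N + N}. prod (divides_value g n) T) - real N * (\<Prod>p\<in>T. \<rho> p / real p)\<bar>
          \<le> prod \<rho> T" if "T \<subseteq> (\<Union>j<J. U j)" for T
        unfolding \<rho>_def
        using that finU by (intro divides_value_average) (auto intro: finite_subset simp: U_def)
      show "(\<Sum>p\<in>U j. \<rho> p / real p) \<le> L" for j
      proof -
        define a where "a = w * 2 ^ j"
        have a: "0 < a" using assms by (simp add: a_def w_def)
        have "(\<Sum>p\<in>U j. \<rho> p / real p) \<le> (\<Sum>p\<in>U j. real D * (1 / real p))"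
          using \<rho>(2) U(1) by (intro sum_mono) (auto intro: divide_right_mono)
        also have "\<dots> = real D * (\<Sum>p | prime p \<and> 2 ^ a < p \<and> p \<le> 2 ^ (a + a). 1 / real p)"
          unfolding U_def z_def a_def by (simp add: sum_distrib_left mult_2 distrib_left)
        also have "\<dots> \<le> real D * (real a * (2 / real a))"
          by (intro mult_left_mono sum_inverse_primes_le a) auto
        also have "\<dots> = L" using a by (simp add: L_def)
        finally show ?thesis .
      qed
      show "(\<Sum>j<J. L ^ Suc (k j) / fact (Suc (k j))) \<le> exp (- 2 * L) / 2"
        unfolding k_def v_def[symmetric]
        by (rule tail_sum_le) (use \<open>0 < v\<close> b0 in \<open>auto simp: L_def b_def\<close>)
      \<comment> \<open>A trivial count suffices: the integers from 2 to \<open>z (Suc j)\<close>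
        leave room for the summand 1, and the factor \<open>D\<close> is absorbed by a second factor
        \<open>z (Suc j)\<close>.\<close>
      have "1 + sum \<rho> (U j) \<le> 2 ^ (2 * (w * 2 ^ Suc j))" for j
      proof -
        have "sum \<rho> (U j) \<le> real (card (U j)) * real D"
          using \<rho>(2) U(1) by (intro sum_bounded_above) auto
        moreover have "card (U j) \<le> card {2..z (Suc j)}"
          using U(1,3) prime_ge_2_nat by (intro card_mono) auto
        moreover have "0 < z (Suc j)" by (simp add: z_def)
        ultimately have "card (U j) + 1 \<le> z (Suc j)" and sum_\<rho>: "sum \<rho> (U j) \<le> real (card (U j)) * real D"
          by simp_all
        then have "1 + card (U j) * D \<le> z (Suc j) * D"
          using assms mult_right_mono[of "card (U j) + 1" "z (Suc j)" D] by simp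
        also have "\<dots> \<le> z (Suc j) * z (Suc j)"
          using Dw z0[of "Suc j"] by (intro mult_left_mono) auto
        also have "\<dots> = 2 ^ (2 * (w * 2 ^ Suc j))"
          unfolding z_def power_add[symmetric] by (simp only: mult_2)
        finally have "real (1 + card (U j) * D) \<le> real (2 ^ (2 * (w * 2 ^ Suc j)))"
          by (simp only: of_nat_le_iff)
        then have "1 + real (card (U j)) * real D \<le> 2 ^ (2 * (w * 2 ^ Suc j))" by simp
        then show ?thesis using sum_\<rho> by linarith
      qed
      then have "(\<Prod>j<J. (1 + sum \<rho> (U j)) ^ Suc (k j)) \<le>
          (\<Prod>j<J. (2 ^ (2 * (w * 2 ^ Suc j))) ^ Suc (k j))"
        using \<rho>(1) U(1) by (intro prod_mono conjI power_mono zero_le_power add_nonneg_nonneg sum_nonneg) auto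
      also have "\<dots> = 2 ^ (\<Sum>j<J. 2 * (w * 2 ^ Suc j) * Suc (k j))"
        by (simp only: power_mult[symmetric] power_sum)
      also have "(\<Sum>j<J. 2 * (w * 2 ^ Suc j) * Suc (k j)) =
          w * (\<Sum>j<J. 2 ^ Suc j * (4 * (b + J - 1 - j) + 2))"
        unfolding sum_distrib_left k_def by (intro sum.cong refl) (simp add: algebra_simps)
      also have "(2::real) ^ \<dots> \<le> E"
        unfolding E_def by (intro power_increasing mult_left_mono block_exponent_sum) auto
      finally show "(\<Prod>j<J. (1 + sum \<rho> (U j)) ^ Suc (k j)) \<le> E" .
    qed (use finU \<rho>(1) U(1) in \<open>auto simp: k_def\<close>)
    moreover have "0 < N * exp (- 2 * L) ^ J / 2 - (1 + real J) * E"
    proof -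
      have "2 * (1 + real J) < 2 ^ (2 ^ J) * exp (- 2 * L) ^ J"
        using elim by simp
      also have "\<dots> \<le> 2 ^ (w * 2 ^ J) * exp (- 2 * L) ^ J"
        using assms by (intro mult_right_mono power_increasing) (auto simp: w_def)
      finally have "2 * (1 + real J) * E < 2 ^ (w * 2 ^ J) * exp (- 2 * L) ^ J * E"
        by (intro mult_strict_right_mono) (auto simp: E_def)
      moreover have "real N = 2 ^ (w * 2 ^ J) * E"
        unfolding N_def E_def B_def of_nat_power of_nat_numeral power_add[symmetric]
        by (rule arg_cong[where f = "\<lambda>i. 2 ^ i"]) (simp add: algebra_simps)
      ultimately show ?thesis by (simp add: mult.commute mult.left_commute)
    qed
    ultimately have "0 < (\<Sum>n\<in>{N..<N + N}. \<Prod>j<J. \<Prod>p\<in>U j. 1 - divides_value g n p)"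
      by linarith
    then obtain n where n: "n \<in> {N..<N + N}" "(\<Prod>j<J. \<Prod>p\<in>U j. 1 - divides_value g n p) \<noteq> 0"
      by (rule sum.not_neutral_contains_not_neutral[OF less_imp_neq[THEN not_sym]])
    have "\<not> int p dvd poly g (int n)" if p: "prime p" "2 ^ w < p" "p \<le> 2 ^ (w * 2 ^ J)" for p
    proof
      assume dvd: "int p dvd poly g (int n)"
      define j where "j = (LEAST i. p \<le> z (Suc i))"
      have "z 0 < p" "p \<le> z J" using p by (auto simp: z_def)
      then obtain i where i: "p \<le> z (Suc i)" "i < J"
        by (metis Suc_leI lessI linorder_not_less not0_implies_Suc)
      have "p \<le> z (Suc j)" unfolding j_def using i(1) by (rule LeastI)
      moreover have "j < J" unfolding j_def using i Least_le[of "\<lambda>i. p \<le> z (Suc i)" i] by linarith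
      moreover have "z j < p"
      proof (cases j)
        case (Suc l)
        then have "\<not> p \<le> z (Suc l)" using not_less_Least[of l "\<lambda>i. p \<le> z (Suc i)"] by (simp add: j_def)
        then show ?thesis using Suc by simp
      qed (use \<open>z 0 < p\<close> in simp)
      ultimately have "p \<in> U j" "j < J" using p(1) by (auto simp: U_def)
      then have "(\<Prod>p\<in>U j. 1 - divides_value g n p) = 0"
        using finU dvd by (intro prod_zero) (auto simp: divides_value_def intro!: bexI[of _ p])
      then show False using n(2) \<open>j < J\<close> by (auto simp: prod_zero_iff)
    qed
    then show ?case using n(1) by (intro bexI[of _ n]) (auto simp: N_def)
  qed
  moreover have "1 \<le> w" "1 \<le> B" using assms by (simp_all add: w_def B_def)
  ultimately show ?thesis by (intro that)
qed

section \<open>Almost prime values of integer polynomials\<close>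

lemma abs_poly_le:
  fixes g :: "int poly"
  assumes "degree g \<le> D" "1 \<le> x"
  shows "\<bar>poly g x\<bar> \<le> (\<Sum>i\<le>degree g. \<bar>coeff g i\<bar>) * x ^ D"
proof -
  have "\<bar>poly g x\<bar> \<le> (\<Sum>i\<le>degree g. \<bar>coeff g i * x ^ i\<bar>)"
    unfolding poly_altdef by (rule sum_abs)
  also have "\<dots> \<le> (\<Sum>i\<le>degree g. \<bar>coeff g i\<bar> * x ^ D)"
    using assms by (intro sum_mono) (auto simp: abs_mult intro!: mult_left_mono power_increasing)
  finally show ?thesis by (simp add: sum_distrib_right)
qed

lemma Omega_le_of_large_prime_factors:
  fixes m :: int
  assumes "m \<noteq> 0" "1 < z" "\<bar>m\<bar> \<le> z ^ r" "\<And>p. prime p \<Longrightarrow> p dvd m \<Longrightarrow> z \<le> p"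
  shows "Omega m \<le> enat r"
proof -
  have "z ^ (\<Sum>p\<in>prime_factors m. multiplicity p m) = (\<Prod>p\<in>prime_factors m. z ^ multiplicity p m)"
    by (rule power_sum)
  also have "\<dots> \<le> (\<Prod>p\<in>prime_factors m. p ^ multiplicity p m)"
    using assms(2,4) by (intro prod_mono conjI power_mono) auto
  also have "\<dots> = \<bar>m\<bar>"
    using assms(1) by (simp add: prod_prime_factors)
  also note assms(3)
  finally show ?thesis
    using assms(1,2) by (simp add: Omega_def)
qed

text \<open>Primes up to \<open>2 ^ w\<close> cannot divide a value congruent to 1 modulo
  \<open>M\<close>, and those from there to \<open>z\<close> are excluded by the sieve. The
  remaining prime factors are at least \<open>z\<close>, while the value is at most a fixed power of
  \<open>z\<close>. Letting \<open>J\<close> grow gives infinitely many \<open>n\<close> with the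
  same \<open>M\<close> and \<open>r\<close>.\<close>

lemma almost_prime_values:
  "\<exists>M>0. \<exists>r. \<forall>g. degree g \<le> D \<longrightarrow> poly g 0 = 1 \<longrightarrow> (\<forall>x. M dvd poly g x - 1) \<longrightarrow>
    infinite {n::nat. Omega (poly g (int n)) \<le> enat r}"
proof -
  define d where "d = max 1 D"
  have "1 \<le> d" by (simp add: d_def)
  obtain w B where w: "1 \<le> w" and B: "1 \<le> B" and sieve: "\<And>g. degree g \<le> d \<Longrightarrow> poly g 0 = 1 \<Longrightarrow>
    \<forall>\<^sub>F J in sequentially. \<exists>n\<in>{2 ^ (w * 2 ^ J * B)..<2 * 2 ^ (w * 2 ^ J * B)}.
      \<forall>p. prime p \<longrightarrow> 2 ^ w < p \<longrightarrow> p \<le> 2 ^ (w * 2 ^ J) \<longrightarrow> \<not> int p dvd poly g (int n)"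

    by (rule eventually_no_medium_prime_factor[OF \<open>1 \<le> d\<close>], rule that)
  \<comment> \<open>Divisible by every prime up to \<open>2 ^ w\<close>.\<close>
  define M :: int where "M = fact (2 ^ w)"
  have "infinite {n::nat. Omega (poly g (int n)) \<le> enat (B * (d + 1))}"
    if g: "degree g \<le> D" "poly g 0 = 1" "\<And>x. M dvd poly g x - 1" for g
    unfolding infinite_nat_iff_unbounded
  proof
    fix K
    \<comment> \<open>Bounds the value by \<open>C * N ^ d\<close>. As \<open>J\<close> is at least
      \<open>C\<close>, one further power of \<open>N\<close> absorbs \<open>C\<close>; this
      explains the exponent \<open>d + 1\<close> in the bound.\<close>
    define C where "C = (\<Sum>i\<le>degree g. \<bar>coeff g i\<bar>) * 2 ^ d"
    have deg: "degree g \<le> d" using g(1) by (simp add: d_def)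
    from eventually_conj[OF sieve[OF deg g(2)] eventually_ge_at_top[of "max K (nat C)"]]
    obtain J n where J: "max K (nat C) \<le> J"
      and n: "n \<in> {2 ^ (w * 2 ^ J * B)..<2 * 2 ^ (w * 2 ^ J * B)}"
      and np: "\<And>p. prime p \<Longrightarrow> 2 ^ w < p \<Longrightarrow> p \<le> 2 ^ (w * 2 ^ J) \<Longrightarrow> \<not> int p dvd poly g (int n)"
      by (auto dest!: eventually_happens'[rotated])
    define z where "z = (2::nat) ^ (w * 2 ^ J)"
    define N where "N = z ^ B"
    have N: "N \<le> n" "n < 2 * N"
      using n by (auto simp: N_def z_def power_mult)
    have "J < 2 ^ J" by (rule less_exp)
    also have "\<dots> \<le> w * 2 ^ J" using w by simp
    also have "\<dots> < z" unfolding z_def by (rule less_exp)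
    also have "z ^ 1 \<le> N"
      unfolding N_def using B by (intro power_increasing) (auto simp: z_def)
    finally have JN: "J < N" by simp
    have no_small: "\<not> p dvd poly g (int n)" if "prime p" "p \<le> 2 ^ w" for p
    proof
      assume dvd: "p dvd poly g (int n)"
      have "p dvd M"
      proof -
        have "nat p dvd fact (2 ^ w)"
          using that prime_ge_2_int[of p] by (subst prime_dvd_fact_iff) (auto simp: nat_le_iff)
        then have "int (nat p) dvd int (fact (2 ^ w))" by (simp only: int_dvd_int_iff)
        then show ?thesis using that prime_ge_2_int[of p] by (simp add: M_def)
      qed
      from dvd_diff[OF dvd dvd_trans[OF this g(3)[of "int n"]]] have "p dvd 1" by simp
      then show False using that by auto
    qed
    have large: "int z \<le> p" if p: "prime p" "p dvd poly g (int n)" for p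
    proof (rule ccontr)
      assume "\<not> int z \<le> p"
      moreover have "2 ^ w < p" using no_small[OF p(1)] p(2) by linarith
      moreover obtain q where q: "p = int q"
        using zero_le_imp_eq_int[OF prime_ge_0_int[OF p(1)]] by blast
      ultimately have "2 ^ w < q" "q \<le> z" by simp_all
      then show False using np[of q] p by (simp add: q z_def)
    qed
    have "(2::int) \<le> 2 ^ w" using w by (simp add: self_le_power)
    then have nz: "poly g (int n) \<noteq> 0" using no_small[of 2] by auto
    have "\<bar>poly g (int n)\<bar> \<le> (\<Sum>i\<le>degree g. \<bar>coeff g i\<bar>) * int n ^ d"
      using JN N deg by (intro abs_poly_le) auto
    also have "\<dots> \<le> (\<Sum>i\<le>degree g. \<bar>coeff g i\<bar>) * int (2 * N) ^ d"
      using N by (intro mult_left_mono power_mono sum_nonneg) auto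
    also have "\<dots> = C * int N ^ d" by (simp add: C_def power_mult_distrib)
    also have "\<dots> \<le> int N * int N ^ d"
      using J JN by (intro mult_right_mono) auto
    also have "\<dots> = int z ^ (B * (d + 1))"
      by (simp add: N_def power_mult power_add)
    finally have "\<bar>poly g (int n)\<bar> \<le> int z ^ (B * (d + 1))" .
    moreover have "1 < int z"
      unfolding z_def of_nat_power using w by (intro one_less_power) auto
    ultimately have "Omega (poly g (int n)) \<le> enat (B * (d + 1))"
      using nz large by (intro Omega_le_of_large_prime_factors[where z = "int z"])
    moreover have "K < n" using J JN N by linarith
    ultimately show "\<exists>n>K. n \<in> {n. Omega (poly g (int n)) \<le> enat (B * (d + 1))}" by blast
  qed
  moreover have "0 < M" by (simp add: M_def)
  ultimately show ?thesis by blast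
qed

section \<open>Polynomial functions along lines\<close>

text \<open>The only feature of polynomial functions that the density arguments use: on a line they
  vanish identically or at finitely many points. In this form, closure under substitution into
  \<open>poly_eval\<close> is immediate.\<close>

definition line_poly :: "((nat \<Rightarrow> complex) \<Rightarrow> complex) \<Rightarrow> bool" where
  "line_poly \<Phi> \<longleftrightarrow> (\<forall>a b. \<exists>P. \<forall>s. \<Phi> (\<lambda>i. a i + s * b i) = poly P s)"

lemma line_polyD:
  assumes "line_poly \<Phi>"
  obtains P where "\<And>s. \<Phi> (\<lambda>i. a i + s * b i) = poly P s"
  using assms unfolding line_poly_def by blast

lemma line_poly_coord: "line_poly (\<lambda>t. t i)"
  unfolding line_poly_def
proof (intro allI)
  fix a b :: "nat \<Rightarrow> complex"
  show "\<exists>P. \<forall>s. a i + s * b i = poly P s"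
    by (rule exI[of _ "[:a i, b i:]"]) simp
qed

lemma line_poly_const: "line_poly (\<lambda>t. c)"
  unfolding line_poly_def by (metis poly_pCons poly_0 mult_zero_right add.right_neutral)

lemma line_poly_add: "line_poly \<Phi> \<Longrightarrow> line_poly \<Psi> \<Longrightarrow> line_poly (\<lambda>t. \<Phi> t + \<Psi> t)"
  unfolding line_poly_def by (metis poly_add)

lemma line_poly_mult: "line_poly \<Phi> \<Longrightarrow> line_poly \<Psi> \<Longrightarrow> line_poly (\<lambda>t. \<Phi> t * \<Psi> t)"
  unfolding line_poly_def by (metis poly_mult)

lemma line_poly_power: "line_poly \<Phi> \<Longrightarrow> line_poly (\<lambda>t. \<Phi> t ^ k)"
  by (induction k) (simp_all add: line_poly_const line_poly_mult)

lemma line_poly_sum: "(\<And>i. i \<in> I \<Longrightarrow> line_poly (\<Phi> i)) \<Longrightarrow> line_poly (\<lambda>t. \<Sum>i\<in>I. \<Phi> i t)"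
  by (induction I rule: infinite_finite_induct) (simp_all add: line_poly_const line_poly_add)

lemma line_poly_prod: "(\<And>i. i \<in> I \<Longrightarrow> line_poly (\<Phi> i)) \<Longrightarrow> line_poly (\<lambda>t. \<Prod>i\<in>I. \<Phi> i t)"
  by (induction I rule: infinite_finite_induct) (simp_all add: line_poly_const line_poly_mult)

lemma line_poly_poly_eval:
  assumes "\<And>i. line_poly (\<lambda>t. g t i)"
  shows "line_poly (\<lambda>t. poly_eval f (g t))"
  unfolding poly_eval_def
  by (intro line_poly_sum line_poly_mult line_poly_prod line_poly_power line_poly_const assms)

text \<open>Irreducibility of affine space in elementary form: on the line joining a point good for
  \<open>I\<close> to a point good for \<open>i\<close>, the product of the restrictions is a
  nonzero polynomial.\<close>

lemma line_poly_common_nonzero: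
  assumes "finite I" "\<And>i. i \<in> I \<Longrightarrow> line_poly (\<Phi> i)"
    "\<And>i. i \<in> I \<Longrightarrow> \<exists>t. (\<forall>j>m. t j = 0) \<and> \<Phi> i t \<noteq> 0"
  shows "\<exists>t. (\<forall>j>m. t j = 0) \<and> (\<forall>i\<in>I. \<Phi> i t \<noteq> 0)"
  using assms
proof (induction I rule: finite_induct)
  case empty
  show ?case by (rule exI[of _ "\<lambda>_. 0"]) simp
next
  case (insert i I)
  obtain a where a: "\<forall>j>m. a j = 0" "\<forall>i\<in>I. \<Phi> i a \<noteq> 0"
    using insert by auto
  obtain b where b: "\<forall>j>m. b j = 0" "\<Phi> i b \<noteq> 0"
    using insert.prems(2) by blast
  define c where "c j = b j - a j" for j
  have lp: "line_poly (\<lambda>t. \<Prod>i\<in>I. \<Phi> i t)"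
    using insert.prems(1) by (intro line_poly_prod) auto
  obtain P where P: "\<And>s. (\<Prod>i\<in>I. \<Phi> i (\<lambda>j. a j + s * c j)) = poly P s"
    using line_polyD[OF lp, of a c] by metis
  have li: "line_poly (\<Phi> i)" using insert.prems(1) by simp
  obtain R where R: "\<And>s. \<Phi> i (\<lambda>j. a j + s * c j) = poly R s"
    using line_polyD[OF li, of a c] by metis
  have "poly P 0 \<noteq> 0" "poly R 1 \<noteq> 0"
    using a(2) b(2) insert.hyps(1) by (simp_all add: P[symmetric] R[symmetric] c_def)
  then have "P * R \<noteq> 0" by auto
  then have "finite {s. poly (P * R) s = 0}" by (rule poly_roots_finite)
  then obtain s where "poly (P * R) s \<noteq> 0"
    using ex_new_if_finite[OF infinite_UNIV_char_0] by blast
  then have "\<forall>k\<in>insert i I. \<Phi> k (\<lambda>j. a j + s * c j) \<noteq> 0"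
    using insert.hyps(1) by (auto simp: P[symmetric] R[symmetric])
  then show ?case using a(1) b(1) by (intro exI[of _ "\<lambda>j. a j + s * c j"]) (simp add: c_def)
qed

text \<open>The coordinates are made integral one at a time.\<close>

lemma line_poly_integer_nonzero:
  assumes "line_poly \<Phi>" "\<forall>j>m. t j = 0" "\<Phi> t \<noteq> 0"
  obtains u :: "nat \<Rightarrow> int" where "\<forall>j>m. u j = 0" "\<Phi> (\<lambda>j. of_int (u j)) \<noteq> 0"
proof -
  have "\<exists>t. (\<forall>j>m. t j = 0) \<and> (\<forall>j<k. t j \<in> \<int>) \<and> \<Phi> t \<noteq> 0" if "k \<le> Suc m" for k
    using that
  proof (induction k)
    case 0
    then show ?case using assms by auto
  next
    case (Suc k)
    then obtain t where t: "\<forall>j>m. t j = 0" "\<forall>j<k. t j \<in> \<int>" "\<Phi> t \<noteq> 0" by auto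
    obtain P where P: "\<Phi> (\<lambda>j. (t(k := 0)) j + s * (if j = k then 1 else 0)) = poly P s" for s
      by (rule line_polyD[OF assms(1), of "t(k := 0)" "\<lambda>j. if j = k then 1 else 0"], rule that)
    have upd: "(\<lambda>j. (t(k := 0)) j + s * (if j = k then 1 else 0)) = t(k := s)" for s
      by (auto simp: fun_eq_iff)
    have "poly P (t k) \<noteq> 0" using t(3) unfolding P[symmetric] upd by simp
    then have "P \<noteq> 0" by auto
    then have "finite {s. poly P s = 0}" by (rule poly_roots_finite)
    moreover have "infinite (\<int> :: complex set)"
      unfolding Ints_def by (simp add: finite_image_iff inj_on_def infinite_UNIV_char_0)
    ultimately obtain s where "s \<in> \<int>" "poly P s \<noteq> 0"
      using finite_subset[of \<int> "{s. poly P s = 0}"] by auto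
    then have s: "s \<in> \<int>" "\<Phi> (t(k := s)) \<noteq> 0" unfolding P[symmetric] upd by auto
    show ?case
    proof (intro exI conjI)
      show "\<forall>j>m. (t(k := s)) j = 0" "\<forall>j<Suc k. (t(k := s)) j \<in> \<int>"
        using t s(1) Suc.prems by (auto simp: less_Suc_eq)
    qed (rule s(2))
  qed
  from this[of "Suc m"] obtain t where t: "\<forall>j>m. t j = 0" "\<forall>j\<le>m. t j \<in> \<int>" "\<Phi> t \<noteq> 0"
    by (auto simp: less_Suc_eq_le)
  have "\<exists>k. t j = of_int k" for j
  proof -
    have "t j \<in> \<int>" using t(1,2) by (cases "j \<le> m") auto
    then show ?thesis by (auto elim: Ints_cases)
  qed
  then obtain u where u: "\<And>j. t j = of_int (u j)" by metis
  then have "t = (\<lambda>j. of_int (u j))" by auto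
  with t(3) have "\<Phi> (\<lambda>j. of_int (u j)) \<noteq> 0" by simp
  moreover have "\<forall>j>m. u j = 0" using t(1) u by simp
  ultimately show ?thesis by (intro that)
qed

section \<open>Integral restrictions of forms to lines\<close>

lemma common_denominator:
  assumes "finite (S :: rat set)"
  obtains K :: int where "0 < K" "\<And>q. q \<in> S \<Longrightarrow> of_int K * q \<in> \<int>"
proof -
  have "\<exists>K::int. 0 < K \<and> (\<forall>q\<in>S. of_int K * q \<in> \<int>)"
    using assms
  proof (induction S rule: finite_induct)
    case empty
    show ?case by (rule exI[of _ 1]) simp
  next
    case (insert q S)
    then obtain K :: int where K: "0 < K" "\<forall>q\<in>S. of_int K * q \<in> \<int>" by blast
    obtain a b where q: "q = Fract a b" "b > 0" by (cases q) auto
    have "of_int (K * b) * q = of_int (K * a)"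
      using q by (simp add: Fract_of_int_quotient)
    moreover have "of_int (K * b) * r \<in> \<int>" if "r \<in> S" for r
    proof -
      have "of_int (K * b) * r = of_int b * (of_int K * r)" by simp
      then show ?thesis using K(2) that by (metis Ints_mult Ints_of_int)
    qed
    ultimately show ?case
      using K(1) q(2) by (intro exI[of _ "K * b"]) (auto simp del: of_int_mult)
  qed
  then show ?thesis using that by blast
qed

text \<open>On a line each monomial becomes a product of \<open>d\<close> factors of degree at most
  one. The degree bound does not depend on \<open>b\<close>, which later makes the number of prime
  factors uniform.\<close>

lemma homogeneous_integer_line:
  fixes a b :: "nat \<Rightarrow> int"
  assumes "homogeneous m d f" "\<And>q. q \<in> Poly_Mapping.lookup f ` Poly_Mapping.keys f \<Longrightarrow> of_int K * q \<in> \<int>"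
  obtains P :: "int poly" where "degree P \<le> d"
    "\<And>s. of_int (poly P s) = of_int K * poly_eval f (\<lambda>j. of_int (a j + s * b j))"
proof -
  have "\<exists>c. \<forall>\<mu>\<in>Poly_Mapping.keys f. of_int K * Poly_Mapping.lookup f \<mu> = of_int (c \<mu>)"
    using assms(2) by (intro bchoice) (auto elim!: Ints_cases)
  then obtain c where c: "\<And>\<mu>. \<mu> \<in> Poly_Mapping.keys f \<Longrightarrow> of_int K * Poly_Mapping.lookup f \<mu> = of_int (c \<mu>)"
    by blast
  define P where "P = (\<Sum>\<mu>\<in>Poly_Mapping.keys f.
    smult (c \<mu>) (\<Prod>i\<in>Poly_Mapping.keys \<mu>. [:a i, b i:] ^ Poly_Mapping.lookup \<mu> i))"
  have "degree P \<le> d"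
    unfolding P_def
  proof (intro degree_sum_le, simp)
    fix \<mu> assume \<mu>: "\<mu> \<in> Poly_Mapping.keys f"
    have "degree (\<Prod>i\<in>Poly_Mapping.keys \<mu>. [:a i, b i:] ^ Poly_Mapping.lookup \<mu> i) \<le>
        (\<Sum>i\<in>Poly_Mapping.keys \<mu>. degree ([:a i, b i:] ^ Poly_Mapping.lookup \<mu> i))"
      using degree_prod_sum_le[of "Poly_Mapping.keys \<mu>"] by (simp add: o_def)
    also have "\<dots> \<le> (\<Sum>i\<in>Poly_Mapping.keys \<mu>. Poly_Mapping.lookup \<mu> i)"
    proof (intro sum_mono)
      fix i
      have "degree ([:a i, b i:] ^ Poly_Mapping.lookup \<mu> i) \<le> degree [:a i, b i:] * Poly_Mapping.lookup \<mu> i"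
        by (rule degree_power_le)
      also have "\<dots> \<le> 1 * Poly_Mapping.lookup \<mu> i" by (intro mult_right_mono) auto
      finally show "degree ([:a i, b i:] ^ Poly_Mapping.lookup \<mu> i) \<le> Poly_Mapping.lookup \<mu> i" by simp
    qed
    also have "\<dots> = d" using assms(1) \<mu> by (simp add: homogeneous_def)
    finally show "degree (smult (c \<mu>) (\<Prod>i\<in>Poly_Mapping.keys \<mu>. [:a i, b i:] ^ Poly_Mapping.lookup \<mu> i)) \<le> d"
      using degree_smult_le order_trans by blast
  qed
  moreover have "of_int (poly P s) = of_int K * poly_eval f (\<lambda>j. of_int (a j + s * b j))" for s
  proof -
    have cc: "complex_of_int (c \<mu>) = of_int K * of_rat (Poly_Mapping.lookup f \<mu>)"
      if "\<mu> \<in> Poly_Mapping.keys f" for \<mu>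
      using arg_cong[OF c[OF that], of "of_rat :: rat \<Rightarrow> complex"] by (simp add: of_rat_mult)
    show ?thesis
      unfolding P_def poly_eval_def sum_distrib_left
      by (simp add: poly_sum poly_prod cc mult.assoc)
  qed
  ultimately show ?thesis by (rule that)
qed

section \<open>Projective points and basic open sets\<close>

lemma poly_eval_scale:
  assumes "homogeneous n d f"
  shows "poly_eval f (\<lambda>i. c * x i) = c ^ d * poly_eval f x"
  unfolding poly_eval_def sum_distrib_left
proof (intro sum.cong refl)
  fix \<mu> assume "\<mu> \<in> Poly_Mapping.keys f"
  then have "d = (\<Sum>i\<in>Poly_Mapping.keys \<mu>. Poly_Mapping.lookup \<mu> i)"
    using assms by (simp add: homogeneous_def)
  then show "of_rat (Poly_Mapping.lookup f \<mu>) * (\<Prod>i\<in>Poly_Mapping.keys \<mu>. (c * x i) ^ Poly_Mapping.lookup \<mu> i) =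
      c ^ d * (of_rat (Poly_Mapping.lookup f \<mu>) * (\<Prod>i\<in>Poly_Mapping.keys \<mu>. x i ^ Poly_Mapping.lookup \<mu> i))"
    by (simp add: power_mult_distrib prod.distrib power_sum)
qed

lemma proj_class_self: "x \<in> proj_class x"
  unfolding proj_class_def by (rule CollectI, rule exI[of _ 1]) simp

lemma proj_class_scale:
  assumes "c \<noteq> 0"
  shows "proj_class (\<lambda>i. c * x i) = proj_class x"
proof (intro set_eqI iffI)
  fix y assume "y \<in> proj_class (\<lambda>i. c * x i)"
  then obtain e where e: "e \<noteq> 0" "y = (\<lambda>i. e * (c * x i))" unfolding proj_class_def by blast
  have "y = (\<lambda>i. (e * c) * x i)" unfolding e(2) by (simp only: mult.assoc)
  moreover have "e * c \<noteq> 0" using assms e(1) by simp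
  ultimately show "y \<in> proj_class x" unfolding proj_class_def by blast
next
  fix y assume "y \<in> proj_class x"
  then obtain e where e: "e \<noteq> 0" "y = (\<lambda>i. e * x i)" unfolding proj_class_def by blast
  have "y = (\<lambda>i. (e / c) * (c * x i))" unfolding e(2) using assms by simp
  moreover have "e / c \<noteq> 0" using assms e(1) by simp
  ultimately show "y \<in> proj_class (\<lambda>i. c * x i)" unfolding proj_class_def by blast
qed

lemma in_basic_open_iff:
  assumes "homogeneous n d f" "x \<in> coord_vectors n"
  shows "proj_class x \<in> basic_open n f \<longleftrightarrow> poly_eval f x \<noteq> 0"
proof
  show "proj_class x \<in> basic_open n f \<Longrightarrow> poly_eval f x \<noteq> 0"
    using proj_class_self by (auto simp: basic_open_def)
  show "poly_eval f x \<noteq> 0 \<Longrightarrow> proj_class x \<in> basic_open n f"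
    using assms by (auto simp: basic_open_def proj_space_def proj_class_def poly_eval_scale)
qed

text \<open>Induction over the generation of the topology. Keeping a finite family of forms means
  that only their values, not the forms themselves, ever have to be multiplied.\<close>

lemma zariski_nhd:
  assumes "openin (zariski n) T" "y \<in> T"
  obtains \<F> where "finite \<F>" "\<And>f. f \<in> \<F> \<Longrightarrow> \<exists>d. homogeneous n d f"
    "\<And>f. f \<in> \<F> \<Longrightarrow> y \<in> basic_open n f"
    "\<And>q. (\<And>f. f \<in> \<F> \<Longrightarrow> q \<in> basic_open n f) \<Longrightarrow> q \<in> T"
proof -
  define nb where "nb \<F> S \<longleftrightarrow> finite \<F> \<and> (\<forall>f\<in>\<F>. (\<exists>d. homogeneous n d f) \<and> y \<in> basic_open n f) \<and>
      (\<forall>q. (\<forall>f\<in>\<F>. q \<in> basic_open n f) \<longrightarrow> q \<in> S)" for \<F> S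
  have "generate_topology_on {basic_open n f |f d. homogeneous n d f} T"
    using assms(1) by (simp add: zariski_def openin_topology_generated_by_iff)
  then have "\<exists>\<F>. nb \<F> T"
    using assms(2)
  proof induction
    case (Int S T)
    then obtain \<F> \<G> where "nb \<F> S" "nb \<G> T" by blast
    then have "nb (\<F> \<union> \<G>) (S \<inter> T)" by (auto simp: nb_def)
    then show ?case by blast
  next
    case (UN \<K>)
    then obtain S where S: "S \<in> \<K>" "y \<in> S" by blast
    from UN.IH[OF this] obtain \<F> where "nb \<F> S" by blast
    then have "nb \<F> (\<Union>\<K>)" unfolding nb_def using S(1) by (meson UnionI)
    then show ?case by blast
  next
    case (Basis S)
    then obtain f d where "S = basic_open n f" "homogeneous n d f" by blast
    with Basis.prems have "nb {f} S" by (auto simp: nb_def)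
    then show ?case by blast
  qed simp
  then show ?thesis using that unfolding nb_def by meson
qed

lemma openin_basic_open: "homogeneous n d f \<Longrightarrow> openin (zariski n) (basic_open n f)"
  unfolding zariski_def openin_topology_generated_by_iff by (rule generate_topology_on.Basis) blast

lemma topspace_zariski_subset: "topspace (zariski n) \<subseteq> proj_space n"
  by (auto simp: zariski_def basic_open_def)

definition var_poly :: "nat \<Rightarrow> qpoly" where
  "var_poly i = Poly_Mapping.single (Poly_Mapping.single i 1) 1"

lemma homogeneous_var_poly: "i \<le> n \<Longrightarrow> homogeneous n 1 (var_poly i)"
  by (simp add: homogeneous_def var_poly_def)

lemma poly_eval_var_poly: "poly_eval (var_poly i) x = x i"
  by (simp add: poly_eval_def var_poly_def)

section \<open>Prime factors of primitive coordinates\<close>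

lemma Omega_nonzero: "m \<noteq> 0 \<Longrightarrow> Omega m = enat (size (prime_factorization m))"
proof -
  assume "m \<noteq> 0"
  moreover have "(\<Sum>p\<in>prime_factors m. multiplicity p m) = size (prime_factorization m)"
    unfolding size_multiset_overloaded_eq
    by (intro sum.cong refl) (simp add: count_prime_factorization_prime in_prime_factors_imp_prime)
  ultimately show ?thesis by (simp add: Omega_def)
qed

lemma Omega_mult: "Omega (a * b) = Omega a + Omega b"
proof (cases "a = 0 \<or> b = 0")
  case False
  then show ?thesis by (simp add: Omega_nonzero prime_factorization_mult)
qed (auto simp: Omega_def)

lemma Omega_dvd_le: "a dvd b \<Longrightarrow> Omega a \<le> Omega b"
  by (auto simp: Omega_mult)

text \<open>Dividing by the gcd can only remove prime factors, so any integral coordinates give an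
  upper bound for \<open>Omega_proj\<close>.\<close>

lemma primitive_coords_quotient:
  fixes x :: "nat \<Rightarrow> int"
  assumes "\<exists>i\<le>n. x i \<noteq> 0"
  obtains a where "primitive_coords n (proj_class (\<lambda>i. if i \<le> n then of_int (x i) else 0)) a"
    "(\<Prod>i\<le>n. a i) dvd (\<Prod>i\<le>n. x i)"
proof -
  define e where "e = Gcd (x ` {..n})"
  define a where "a i = x i div e" for i
  have "e \<noteq> 0" using assms by (auto simp: e_def)
  have x: "x i = e * a i" if "i \<le> n" for i
    using that by (simp add: a_def e_def Gcd_dvd)
  have "Gcd ((*) e ` a ` {..n}) = e"
  proof -
    have "(\<lambda>i. e * a i) ` {..n} = x ` {..n}"
      by (intro image_cong) (auto simp: x)
    then show ?thesis by (simp add: image_image e_def)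
  qed
  moreover have "0 \<le> e" "0 \<le> Gcd (a ` {..n})" by (simp_all add: e_def)
  ultimately have "e * Gcd (a ` {..n}) = e" by (simp add: Gcd_mult abs_mult)
  then have "Gcd (a ` {..n}) = 1" using \<open>e \<noteq> 0\<close> by simp
  moreover have "proj_class (\<lambda>i. if i \<le> n then complex_of_int (x i) else 0) =
      proj_class (\<lambda>i. if i \<le> n then of_int (a i) else 0)"
  proof -
    have eq: "(\<lambda>i. if i \<le> n then complex_of_int (x i) else 0) =
        (\<lambda>i. of_int e * (if i \<le> n then of_int (a i) else 0))"
      using x by (auto simp: fun_eq_iff)
    show ?thesis unfolding eq using \<open>e \<noteq> 0\<close> by (intro proj_class_scale) simp
  qed
  moreover have "(\<Prod>i\<le>n. a i) dvd (\<Prod>i\<le>n. x i)"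
    using x by (intro prod_dvd_prod) auto
  ultimately show ?thesis by (intro that[of a]) (auto simp: primitive_coords_def)
qed

section \<open>Density of almost prime points\<close>

theorem theorem1p2:
  fixes n :: nat and X :: "ppoint set"
  assumes "smooth_variety n X"
    and "\<not> in_coord_hyperplane n X"
    and "unirational n X"
  shows "saturation_number n X < \<infinity>"
proof -
  obtain m F where rep: "represents_rational_map m n F"
    and dense: "zariski_dense_in n (rational_map_image m n F) X"
    using assms(3) by (auto simp: unirational_def)
  obtain d where F: "\<And>i. i \<le> n \<Longrightarrow> homogeneous m d (F i)"
    using rep by (auto simp: represents_rational_map_def)
  define I where "I = rational_map_image m n F"
  define \<phi> where "\<phi> t i = (if i \<le> n then poly_eval (F i) t else 0)" for t i
  have \<phi>: "line_poly (\<lambda>t. \<phi> t i)" for i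
    using line_poly_poly_eval[of "\<lambda>t. t" "F i"] line_poly_coord line_poly_const
    by (cases "i \<le> n") (auto simp: \<phi>_def)
  have X_top: "X \<subseteq> topspace (zariski n)"
    using dense closure_of_subset_topspace unfolding zariski_dense_in_def by (rule order_trans[OF conjunct2])
  have IX: "I \<subseteq> X" using dense by (simp add: zariski_dense_in_def I_def)
  have I_iff: "y \<in> I \<longleftrightarrow> (\<exists>t. y = proj_class (\<phi> t) \<and> t \<in> coord_vectors m \<and> (\<exists>i\<le>n. \<phi> t i \<noteq> 0))" for y
    unfolding I_def rational_map_image_def \<phi>_def by auto
  have \<phi>_coord: "\<phi> t \<in> coord_vectors n" if "\<exists>i\<le>n. \<phi> t i \<noteq> 0" for t
    using that by (auto simp: coord_vectors_def \<phi>_def)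
  have meets: "\<exists>y\<in>I. y \<in> T" if "openin (zariski n) T" "p \<in> T" "p \<in> X" for p T
  proof -
    have "p \<in> zariski n closure_of I"
      using dense that(3) unfolding zariski_dense_in_def I_def by blast
    then show ?thesis using that(1,2) unfolding in_closure_of by blast
  qed

  \<comment> \<open>The coordinate \<open>x i\<close> is nonzero somewhere on \<open>X\<close>,
    hence at some point of the dense image.\<close>
  have "\<exists>t. (\<forall>j>m. t j = 0) \<and> poly_eval (F i) t \<noteq> 0" if i: "i \<le> n" for i
  proof -
    obtain p x where p: "p \<in> X" "x \<in> p" "x i \<noteq> 0"
      using assms(2) i by (auto simp: in_coord_hyperplane_def)
    have "p \<in> proj_space n"
      using X_top p(1) topspace_zariski_subset[of n] by blast
    then obtain x0 where x0: "p = proj_class x0" "x0 \<in> coord_vectors n" by (auto simp: proj_space_def)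
    then have "x0 i \<noteq> 0" using p(2,3) by (auto simp: proj_class_def)
    then have "p \<in> basic_open n (var_poly i)"
      using x0 in_basic_open_iff[OF homogeneous_var_poly[OF i] x0(2)] by (simp add: poly_eval_var_poly)
    then obtain y where y: "y \<in> I" "y \<in> basic_open n (var_poly i)"
      using meets openin_basic_open[OF homogeneous_var_poly[OF i]] p(1) by blast
    then obtain t where t: "y = proj_class (\<phi> t)" "t \<in> coord_vectors m" "\<exists>i\<le>n. \<phi> t i \<noteq> 0"
      by (auto simp: I_iff)
    then have "\<phi> t i \<noteq> 0"
      using y(2) in_basic_open_iff[OF homogeneous_var_poly[OF i] \<phi>_coord] by (simp add: poly_eval_var_poly)
    then show ?thesis using t(2) i by (auto simp: \<phi>_def coord_vectors_def)
  qed
  then have F_nonzero: "\<exists>t. (\<forall>j>m. t j = 0) \<and> \<phi> t i \<noteq> 0" if "i \<in> {..n}" for i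
    using that by (simp add: \<phi>_def)
  \<comment> \<open>The base point \<open>a\<close> of all lines below is fixed before the open set is chosen, so \<open>c\<close> and hence
    the bound \<open>R\<close> do not depend on that set. The factor \<open>t 0\<close> excludes the zero vector.\<close>
  define \<Theta> where "\<Theta> t = t 0 * (\<Prod>i\<le>n. \<phi> t i)" for t
  have \<Theta>: "line_poly \<Theta>"
    unfolding \<Theta>_def[abs_def] by (intro line_poly_mult line_poly_prod line_poly_coord \<phi>)
  have "\<exists>t. (\<forall>j>m. t j = 0) \<and> \<Theta> t \<noteq> 0"
  proof -
    \<comment> \<open>The index \<open>Suc n\<close> carries the extra factor \<open>t 0\<close> of
      \<open>\<Theta>\<close>.\<close>
    define \<Phi> where "\<Phi> i = (if i \<le> n then (\<lambda>t. \<phi> t i) else (\<lambda>t. t 0))" for i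
    have "\<exists>t. (\<forall>j>m. t j = 0) \<and> (\<forall>i\<in>{..Suc n}. \<Phi> i t \<noteq> 0)"
    proof (rule line_poly_common_nonzero)
      show "line_poly (\<Phi> i)" for i using \<phi> line_poly_coord by (simp add: \<Phi>_def)
      show "\<exists>t. (\<forall>j>m. t j = 0) \<and> \<Phi> i t \<noteq> 0" for i
      proof (cases "i \<le> n")
        case False
        then show ?thesis by (intro exI[of _ "\<lambda>j. if j = 0 then 1 else 0"]) (simp add: \<Phi>_def)
      qed (use F_nonzero in \<open>simp add: \<Phi>_def\<close>)
    qed simp
    then obtain t where t: "\<forall>j>m. t j = 0" "\<forall>i\<in>{..Suc n}. \<Phi> i t \<noteq> 0" by blast
    have "t 0 \<noteq> 0" using bspec[OF t(2), of "Suc n"] by (simp add: \<Phi>_def)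
    moreover have "\<phi> t i \<noteq> 0" if "i \<le> n" for i
      using bspec[OF t(2), of i] that by (simp add: \<Phi>_def)
    ultimately have "\<Theta> t \<noteq> 0" by (auto simp: \<Theta>_def)
    with t(1) show ?thesis by blast
  qed
  then obtain a :: "nat \<Rightarrow> int" where a: "\<forall>j>m. a j = 0" "\<Theta> (\<lambda>j. of_int (a j)) \<noteq> 0"
    using line_poly_integer_nonzero[OF \<Theta>] by metis

  obtain K :: int where K: "0 < K"
    "\<And>q. q \<in> (\<Union>i\<le>n. Poly_Mapping.lookup (F i) ` Poly_Mapping.keys (F i)) \<Longrightarrow> of_int K * q \<in> \<int>"
    using common_denominator[of "\<Union>i\<le>n. Poly_Mapping.lookup (F i) ` Poly_Mapping.keys (F i)"]
    by (metis (no_types, lifting) finite_UN finite_atMost finite_imageI finite_keys)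
  have line: "\<exists>P :: nat \<Rightarrow> int poly. \<forall>i\<le>n. degree (P i) \<le> d \<and>
      (\<forall>s. of_int (poly (P i) s) = of_int K * \<phi> (\<lambda>j. of_int (a j + s * b j)) i)" for b
  proof -
    have "\<forall>i\<in>{..n}. \<exists>P :: int poly. degree P \<le> d \<and>
      (\<forall>s. of_int (poly P s) = of_int K * \<phi> (\<lambda>j. of_int (a j + s * b j)) i)"
    proof
      fix i assume "i \<in> {..n}"
      then have i: "i \<le> n" by simp
      have "of_int K * q \<in> \<int>" if "q \<in> Poly_Mapping.lookup (F i) ` Poly_Mapping.keys (F i)" for q
        using K(2) i that by blast
      from homogeneous_integer_line[OF F[OF i] this, of a b]
      show "\<exists>P :: int poly. degree P \<le> d \<and>
          (\<forall>s. of_int (poly P s) = of_int K * \<phi> (\<lambda>j. of_int (a j + s * b j)) i)"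
        using i by (metis \<phi>_def)
    qed
    from bchoice[OF this] show ?thesis by auto
  qed

  \<comment> \<open>Direction 0 is chosen only to obtain the integers \<open>K * F i\<close> at
    \<open>a\<close>, before any open set is given.\<close>
  obtain P0 :: "nat \<Rightarrow> int poly" where
    P0: "\<forall>i\<le>n. of_int (poly (P0 i) 0) = of_int K * \<phi> (\<lambda>j. of_int (a j)) i"
    using line[of "\<lambda>_. 0"] by auto
  define c where "c = (\<Prod>i\<le>n. poly (P0 i) 0)"
  have c: "c \<noteq> 0"
  proof
    assume "c = 0"
    then obtain i where "i \<le> n" "poly (P0 i) 0 = 0" by (auto simp: c_def)
    then have "\<phi> (\<lambda>j. of_int (a j)) i = 0" using P0 K(1) by force
    then show False using a(2) \<open>i \<le> n\<close> by (auto simp: \<Theta>_def)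
  qed
  obtain M :: int and r :: nat where M: "0 < M" and almost: "\<And>g. degree g \<le> Suc n * d \<Longrightarrow> poly g 0 = 1 \<Longrightarrow>
      (\<And>x. M dvd poly g x - 1) \<Longrightarrow> infinite {s::nat. Omega (poly g (int s)) \<le> enat r}"
    using almost_prime_values[of "Suc n * d"] by blast
  define R where "R = Omega c + enat r"
  have "R \<noteq> \<infinity>" using c by (simp add: R_def Omega_def)

  have "\<exists>q\<in>{p \<in> rational_points X. Omega_proj n p \<le> R}. q \<in> T"
    if T: "openin (zariski n) T" "p \<in> T" and p: "p \<in> X" for p T
  proof -
    obtain y where y: "y \<in> I" "y \<in> T" using meets[OF T p] by blast
    then obtain u where u: "y = proj_class (\<phi> u)" "u \<in> coord_vectors m" "\<exists>i\<le>n. \<phi> u i \<noteq> 0"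
      by (auto simp: I_iff)
    obtain \<F> where \<F>: "finite \<F>" "\<And>f. f \<in> \<F> \<Longrightarrow> \<exists>d. homogeneous n d f"
      "\<And>f. f \<in> \<F> \<Longrightarrow> y \<in> basic_open n f"
      "\<And>q. (\<And>f. f \<in> \<F> \<Longrightarrow> q \<in> basic_open n f) \<Longrightarrow> q \<in> T"
      using zariski_nhd[OF T(1) y(2)] by metis
    define \<Psi> where "\<Psi> t = t 0 * (\<Prod>f\<in>\<F>. poly_eval f (\<phi> t))" for t
    have \<Psi>': "line_poly (\<lambda>t. \<Prod>f\<in>\<F>. poly_eval f (\<phi> t))"
      by (intro line_poly_prod line_poly_poly_eval \<phi>)
    have "(\<Prod>f\<in>\<F>. poly_eval f (\<phi> u)) \<noteq> 0"
    proof -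
      have "poly_eval f (\<phi> u) \<noteq> 0" if "f \<in> \<F>" for f
        using \<F>(2,3)[OF that] in_basic_open_iff[OF _ \<phi>_coord[OF u(3)]] u(1) by blast
      then show ?thesis using \<F>(1) by simp
    qed
    moreover have "\<forall>j>m. u j = 0" using u(2) by (simp add: coord_vectors_def)
    ultimately obtain v :: "nat \<Rightarrow> int" where v: "\<forall>j>m. v j = 0"
      "(\<Prod>f\<in>\<F>. poly_eval f (\<phi> (\<lambda>j. of_int (v j)))) \<noteq> 0"
      using line_poly_integer_nonzero[OF \<Psi>'] by metis
    \<comment> \<open>The line passes through \<open>a\<close> at parameter 0 and through
      \<open>v\<close>, whose image lies in the given open set, at parameter 1.\<close>
    define b where "b j = v j - a j" for j
    obtain P where degP: "\<And>i. i \<le> n \<Longrightarrow> degree (P i) \<le> d"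
      and P: "\<And>i s. i \<le> n \<Longrightarrow> of_int (poly (P i) s) = of_int K * \<phi> (\<lambda>j. of_int (a j + s * b j)) i"
      using line[of b] by blast
    define G where "G = (\<Prod>i\<le>n. P i)"
    have G0: "poly G 0 = c"
    proof -
      have "poly (P i) 0 = poly (P0 i) 0" if "i \<le> n" for i
      proof -
        have "complex_of_int (poly (P i) 0) = of_int (poly (P0 i) 0)"
          using P[OF that, of 0] P0 that by simp
        then show ?thesis by (simp only: of_int_eq_iff)
      qed
      then show ?thesis by (simp add: G_def c_def poly_prod)
    qed
    have degG: "degree G \<le> Suc n * d"
    proof -
      have "degree G \<le> (\<Sum>i\<le>n. degree (P i))"
        unfolding G_def using degree_prod_sum_le[of "{..n}" P] by (simp add: o_def)
      also have "\<dots> \<le> (\<Sum>i\<le>n. d)" using degP by (intro sum_mono) auto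
      finally show ?thesis by simp
    qed
    obtain Q where Q: "G = pCons c Q"
      using G0 by (cases G) auto
    \<comment> \<open>Writing \<open>G = c + x * Q\<close>, the substitution of
      \<open>c * M * x\<close> for \<open>x\<close> gives
      \<open>c * (1 + M * x * Q(c * M * x))\<close>: the multiple of \<open>c\<close> lets
      \<open>c\<close> be factored out, the multiple of \<open>M\<close> yields the
      congruence.\<close>
    define g where "g = [:1:] + smult M (pCons 0 (Q \<circ>\<^sub>p [:0, c * M:]))"
    have g: "poly g x = 1 + M * (x * poly Q (c * M * x))" for x
      by (simp add: g_def poly_pcompose mult.commute)
    have Gg: "poly G (c * M * x) = c * poly g x" for x
      by (simp add: Q g algebra_simps)
    have "degree g \<le> Suc n * d"
    proof (cases "Q = 0")
      case False
      then have "Suc (degree Q) \<le> Suc n * d" using degG by (simp add: Q)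
      moreover have "degree (Q \<circ>\<^sub>p [:0, c * M:]) \<le> degree Q"
        using degree_pcompose_le[of Q "[:0, c * M:]"] c M by simp
      ultimately have "degree (smult M (pCons 0 (Q \<circ>\<^sub>p [:0, c * M:]))) \<le> Suc n * d"
        using degree_smult_le[of M "pCons 0 (Q \<circ>\<^sub>p [:0, c * M:])"]
          degree_pCons_le[of 0 "Q \<circ>\<^sub>p [:0, c * M:]"] by linarith
      then show ?thesis unfolding g_def by (intro degree_add_le) auto
    qed (simp add: g_def)
    then have inf: "infinite {s::nat. Omega (poly g (int s)) \<le> enat r}"
      by (rule almost) (simp_all add: g)

    have \<Psi>: "line_poly \<Psi>"
      unfolding \<Psi>_def[abs_def] by (intro line_poly_mult line_poly_coord \<Psi>')
    obtain H where H: "\<Psi> (\<lambda>j. of_int (a j) + s * of_int (b j)) = poly H s" for s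
      by (rule line_polyD[OF \<Psi>, of "\<lambda>j. of_int (a j)" "\<lambda>j. of_int (b j)"], rule that)
    \<comment> \<open>The two factors of \<open>\<Psi>\<close> are known to be nonzero at different
      ends of the line: \<open>t 0\<close> at \<open>a\<close>, the product of the forms at
      \<open>v\<close>.\<close>
    have "H \<noteq> 0"
    proof -
      obtain H1 where H1: "(of_int (a 0) + s * of_int (b 0)) = poly H1 s" for s :: complex
        by (rule line_polyD[OF line_poly_coord[of 0], of "\<lambda>j. of_int (a j)" "\<lambda>j. of_int (b j)"], rule that)
      obtain H2 where H2: "(\<Prod>f\<in>\<F>. poly_eval f (\<phi> (\<lambda>j. of_int (a j) + s * of_int (b j)))) = poly H2 s" for s
        by (rule line_polyD[OF \<Psi>', of "\<lambda>j. of_int (a j)" "\<lambda>j. of_int (b j)"], rule that)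
      have "poly H1 0 \<noteq> 0" using a(2) unfolding H1[symmetric] by (auto simp: \<Theta>_def)
      moreover have "poly H2 1 \<noteq> 0" using v(2) unfolding H2[symmetric] by (simp add: b_def)
      ultimately have "H1 * H2 \<noteq> 0" by auto
      moreover have "poly H = poly (H1 * H2)"
        by (auto simp: fun_eq_iff H[symmetric] H1[symmetric] H2[symmetric] \<Psi>_def)
      ultimately show ?thesis by (metis poly_eq_poly_eq_iff)
    qed
    then have "finite {s. poly H s = 0}" by (rule poly_roots_finite)
    moreover have "inj (\<lambda>s::nat. complex_of_int (c * M * int s))"
      using c M by (auto simp: inj_on_def)
    ultimately have "finite ((\<lambda>s::nat. complex_of_int (c * M * int s)) -` {s. poly H s = 0})"
      by (rule finite_vimageI)
    then have "\<not> {s::nat. Omega (poly g (int s)) \<le> enat r} \<subseteq>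
        (\<lambda>s::nat. complex_of_int (c * M * int s)) -` {s. poly H s = 0}"
      using inf finite_subset by blast
    then obtain s :: nat where s: "Omega (poly g (int s)) \<le> enat r"
      "poly H (of_int (c * M * int s)) \<noteq> 0"
      by blast
    define t where "t j = a j + c * M * int s * b j" for j
    define x where "x i = poly (P i) (c * M * int s)" for i
    have prod_x: "(\<Prod>i\<le>n. x i) = c * poly g (int s)"
      unfolding x_def Gg[symmetric] by (simp add: G_def poly_prod)
    have \<Psi>t: "\<Psi> (\<lambda>j. of_int (t j)) \<noteq> 0"
      using s(2) unfolding H[symmetric] by (simp add: t_def)
    then have t: "(\<lambda>j. of_int (t j)) \<in> coord_vectors m"
      using a(1) v(1) by (auto simp: coord_vectors_def \<Psi>_def t_def b_def)
    have x: "of_int (x i) = of_int K * \<phi> (\<lambda>j. of_int (t j)) i" if "i \<le> n" for i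
      unfolding x_def t_def using P[OF that] by simp
    have gs: "poly g (int s) \<noteq> 0" using s(1) by (auto simp: Omega_def)
    then have "x i \<noteq> 0" if "i \<le> n" for i
      using prod_x c that by (metis atMost_iff finite_atMost mult_eq_0_iff prod_zero_iff)
    then have x0: "x 0 \<noteq> 0" by simp
    define q where "q = proj_class (\<phi> (\<lambda>j. of_int (t j)))"
    have \<phi>t: "\<exists>i\<le>n. \<phi> (\<lambda>j. of_int (t j)) i \<noteq> 0"
      using x[of 0] x0 by (intro exI[of _ 0]) auto
    have q_eq: "q = proj_class (\<lambda>i. if i \<le> n then of_int (x i) else 0)"
    proof -
      have "(\<lambda>i. if i \<le> n then complex_of_int (x i) else 0) = (\<lambda>i. of_int K * \<phi> (\<lambda>j. of_int (t j)) i)"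
        using x by (auto simp: fun_eq_iff \<phi>_def)
      then show ?thesis using K(1) by (simp add: q_def proj_class_scale)
    qed
    obtain e where e: "primitive_coords n q e" "(\<Prod>i\<le>n. e i) dvd (\<Prod>i\<le>n. x i)"
      unfolding q_eq using primitive_coords_quotient[of n x] x0 by blast
    have "Omega_proj n q = Omega (\<Prod>i\<le>n. e i)" by (rule Omega_proj_eq) (rule e(1))
    also have "\<dots> \<le> Omega c + Omega (poly g (int s))"
      using Omega_dvd_le[OF e(2)] by (simp add: prod_x Omega_mult)
    also have "\<dots> \<le> R" unfolding R_def using s(1) by (rule add_left_mono)
    finally have "Omega_proj n q \<le> R" .
    moreover have "q \<in> X" using IX I_iff t \<phi>t q_def by blast
    moreover have "\<exists>x\<in>q. \<forall>i. x i \<in> \<rat>"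
      unfolding q_eq by (rule bexI[OF _ proj_class_self]) simp
    moreover have "q \<in> T"
    proof (rule \<F>(4))
      fix f assume f: "f \<in> \<F>"
      then have "poly_eval f (\<phi> (\<lambda>j. of_int (t j))) \<noteq> 0"
        using \<Psi>t \<F>(1) by (auto simp: \<Psi>_def)
      then show "q \<in> basic_open n f"
        unfolding q_def using \<F>(2)[OF f] in_basic_open_iff[OF _ \<phi>_coord[OF \<phi>t]] by blast
    qed
    ultimately show ?thesis by (auto simp: rational_points_def)
  qed
  then have "X \<subseteq> zariski n closure_of {p \<in> rational_points X. Omega_proj n p \<le> R}"
    unfolding subset_iff in_closure_of using X_top by blast
  then have "zariski_dense_in n {p \<in> rational_points X. Omega_proj n p \<le> R} X"
    unfolding zariski_dense_in_def by (auto simp: rational_points_def)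
  then have "saturation_number n X \<le> R"
    unfolding saturation_number_def by (intro Inf_lower) simp
  also have "R < \<infinity>" using \<open>R \<noteq> \<infinity>\<close> by simp
  finally show ?thesis .
qed

end
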